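(* Let $C$ be a bivariate copula with $\gamma(C)=\gamma$. Then \[ 0\leqslant\mu_\infty(C)\leqslant\begin{cases} \dfrac{\sqrt{\gamma+1}}{2}, & \text{if } -1\leqslant\gamma\leqslant-\frac34,\\[2mm] \dfrac{\sqrt{5\gamma+4}+2}{10}, & \text{if } -\frac34\leqslant\gamma\leqslant-\frac49,\\[2mm] \dfrac13, & \text{if } -\frac49\leqslant\gamma\leqslant-\frac13,\\[2mm] \dfrac{\sqrt{15-3\gamma}-3}{3}, & \text{if } -\frac13\leqslant\gamma\leqslant\frac5{16},\\[2mm] \dfrac{\sqrt{20-19\gamma}+1}{19}, & \text{if } \frac5{16}\leqslant\gamma\leqslant\frac{16}{25},\\[2mm] \dfrac{\sqrt{9-11\gamma}+3}{22}, & \text{if } \frac{16}{25}\leqslant\gamma\leqslant\frac79,\\[2mm] \dfrac{\sqrt{2-2\gamma}}{4}, & \text{if } \frac79\leqslant\gamma\leqslant1, \end{cases} \] and the bounds are attained (for each $\gamma\in[-1,1]$, both the lower and the upper bound are attained by some copula $C$ with $\gamma(C)=\gamma$).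
   Context: For a bivariate copula $C$, the measure of asymmetry is $\mu_\infty(C)=\max_{u,v\in[0,1]}|C(u,v)-C(v,u)|$. For copulas $C_1,C_2$ the concordance function is $\mathcal{Q}(C_1,C_2)=4\int_{[0,1]^2}C_2(u,v)\,dC_1(u,v)-1$. Gini's gamma is $\gamma(C)=\mathcal{Q}(C,M)+\mathcal{Q}(C,W)$, where $M(u,v)=\min\{u,v\}$ and $W(u,v)=\max\{0,u+v-1\}$. *)

theory Defs
  imports "HOL-Analysis.Analysis"
begin

text \<open>
  Only the values on the unit square are constrained; every notion below depends
  on those values alone.
\<close>

definition copula :: "(real \<Rightarrow> real \<Rightarrow> real) \<Rightarrow> bool" where
  "copula C \<longleftrightarrow>
     (\<forall>u\<in>{0..1}. C u 0 = 0 \<and> C 0 u = 0) \<and>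
     (\<forall>u\<in>{0..1}. C u 1 = u \<and> C 1 u = u) \<and>
     (\<forall>u1\<in>{0..1}. \<forall>u2\<in>{0..1}. \<forall>v1\<in>{0..1}. \<forall>v2\<in>{0..1}.
        u1 \<le> u2 \<longrightarrow> v1 \<le> v2 \<longrightarrow> C u2 v2 - C u2 v1 - C u1 v2 + C u1 v1 \<ge> 0)"

definition copula_M :: "real \<Rightarrow> real \<Rightarrow> real" where
  "copula_M u v = min u v"

definition copula_W :: "real \<Rightarrow> real \<Rightarrow> real" where
  "copula_W u v = max 0 (u + v - 1)"

text \<open>
  The measure \<open>dC\<close>: the Borel measure on the unit square that gives each
  box \<open>[0,u] \<times> [0,v]\<close> the mass \<open>C u v\<close>. For a copula it exists, and it is
  unique because these boxes are closed under intersection and generate the Borel sets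
  of the square.
\<close>

definition copula_measure :: "(real \<Rightarrow> real \<Rightarrow> real) \<Rightarrow> (real \<times> real) measure" where
  "copula_measure C =
     extend_measure ({0..1} \<times> {0..1}) ({0..1} \<times> {0..1})
       (\<lambda>(u, v). {0..u} \<times> {0..v}) (\<lambda>(u, v). ennreal (C u v))"

definition concordance ::
    "(real \<Rightarrow> real \<Rightarrow> real) \<Rightarrow> (real \<Rightarrow> real \<Rightarrow> real) \<Rightarrow> real" where
  "concordance C1 C2 = 4 * (LINT (u, v)|copula_measure C1. C2 u v) - 1"

definition gini_gamma :: "(real \<Rightarrow> real \<Rightarrow> real) \<Rightarrow> real" where
  "gini_gamma C = concordance C copula_M + concordance C copula_W"

text \<open>The supremum is a maximum for copulas, since they are continuous on the square.\<close>

definition asymmetry :: "(real \<Rightarrow> real \<Rightarrow> real) \<Rightarrow> real" where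
  "asymmetry C = (SUP (u, v)\<in>{0..1} \<times> {0..1}. \<bar>C u v - C v u\<bar>)"

text \<open>Neighbouring branches agree at the common endpoints of their closed intervals.\<close>

definition asymmetry_bound :: "real \<Rightarrow> real" where
  "asymmetry_bound g =
     (if g \<le> - 3/4 then sqrt (g + 1) / 2
      else if g \<le> - 4/9 then (sqrt (5 * g + 4) + 2) / 10
      else if g \<le> - 1/3 then 1/3
      else if g \<le> 5/16 then (sqrt (15 - 3 * g) - 3) / 3
      else if g \<le> 16/25 then (sqrt (20 - 19 * g) + 1) / 19
      else if g \<le> 7/9 then (sqrt (9 - 11 * g) + 3) / 22
      else sqrt (2 - 2 * g) / 4)"

end

theory Submission
  imports Defs
begin

text \<open>
  Layer-cake integration of \<open>min u v\<close> and \<open>max 0 (u + v - 1)\<close> against \<open>dC\<close> gives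
  \<open>\<gamma>(C) = 4 (\<integral> C(t,t) dt + \<integral> C(t,1-t) dt) - 2\<close>, so \<open>\<gamma>\<close> sees only the two diagonals. By
  transposition let \<open>a \<le> b\<close> and \<open>d = C(a,b) - C(b,a) \<ge> 0\<close>; then \<open>d \<le> a\<close>, \<open>d \<le> b - a\<close> and
  \<open>d \<le> 1 - b\<close>, in particular \<open>d \<le> 1/3\<close>. The Lipschitz property propagates
  \<open>C(a,b) \<ge> d + max 0 (a + b - 1)\<close> and \<open>C(b,a) \<le> a - d\<close> to bounds for \<open>C\<close> on both diagonals. Replacing
  \<open>(a,b)\<close> by the worst case, \<open>(d, 1-d)\<close> below and \<open>(d, 2d)\<close> above, leaves piecewise linear functions
  of \<open>d\<close> alone; their integrals bound \<open>\<gamma>\<close> by quadratics in \<open>d\<close> whose inverses are the branches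
  of the claimed bound. Two shuffles of \<open>M\<close> realise the two worst cases, and on the plateau
  \<open>d = 1/3\<close> both use the same point \<open>(1/3, 2/3)\<close>, so their convex combinations fill it.
\<close>

subsection \<open>Copulas and two shuffles of M\<close>

lemma copula_volume:
  assumes "copula C" "0 \<le> u1" "u1 \<le> u2" "u2 \<le> 1" "0 \<le> v1" "v1 \<le> v2" "v2 \<le> 1"
  shows "C u2 v2 - C u2 v1 - C u1 v2 + C u1 v1 \<ge> 0"
  using assms unfolding copula_def by auto

lemma copula_boundary:
  assumes "copula C" "0 \<le> u" "u \<le> 1"
  shows "C u 0 = 0" "C 0 u = 0" "C u 1 = u" "C 1 u = u"
  using assms unfolding copula_def by auto

lemma copulaI:
  assumes "\<And>u. 0 \<le> u \<Longrightarrow> u \<le> 1 \<Longrightarrow> C u 0 = 0" "\<And>u. 0 \<le> u \<Longrightarrow> u \<le> 1 \<Longrightarrow> C 0 u = 0"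
    and "\<And>u. 0 \<le> u \<Longrightarrow> u \<le> 1 \<Longrightarrow> C u 1 = u" "\<And>u. 0 \<le> u \<Longrightarrow> u \<le> 1 \<Longrightarrow> C 1 u = u"
    and "\<And>u1 u2 v1 v2. \<lbrakk>0 \<le> u1; u1 \<le> u2; u2 \<le> 1; 0 \<le> v1; v1 \<le> v2; v2 \<le> 1\<rbrakk> \<Longrightarrow>
      C u2 v2 - C u2 v1 - C u1 v2 + C u1 v1 \<ge> 0"
  shows "copula C"
  unfolding copula_def using assms by (intro conjI ballI impI) (simp_all only: atLeastAtMost_iff)

lemma copula_mono:
  assumes C: "copula C" and "0 \<le> u1" "u1 \<le> u2" "u2 \<le> 1" "0 \<le> v1" "v1 \<le> v2" "v2 \<le> 1"
  shows "C u1 v1 \<le> C u2 v2"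
proof -
  have "C u1 v1 \<le> C u2 v1"
    using copula_volume[OF C, of u1 u2 0 v1] copula_boundary(1)[OF C, of u1] copula_boundary(1)[OF C, of u2] assms
    by simp
  moreover have "C u2 v1 \<le> C u2 v2"
    using copula_volume[OF C, of 0 u2 v1 v2] copula_boundary(2)[OF C, of v1] copula_boundary(2)[OF C, of v2] assms
    by simp
  ultimately show ?thesis by simp
qed

text \<open>The uniform margins bound the mass of a strip by its width, and monotonicity makes a
  falling coordinate free of charge. The positive parts matter: the bounds on the antidiagonal
  combine a rise in one coordinate with a fall in the other.\<close>

lemma copula_lipschitz:
  assumes C: "copula C" and "u1 \<in> {0..1}" "u2 \<in> {0..1}" "v1 \<in> {0..1}" "v2 \<in> {0..1}"
  shows "C u2 v2 \<le> C u1 v1 + max 0 (u2 - u1) + max 0 (v2 - v1)"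
proof -
  have m: "max a b - a = max 0 (b - a)" for a b :: real by (simp add: max_def)
  have 1: "C u2 v2 \<le> C (max u1 u2) (max v1 v2)"
    by (rule copula_mono[OF C]) (use assms in auto)
  have 2: "C (max u1 u2) (max v1 v2) \<le> C u1 (max v1 v2) + (max u1 u2 - u1)"
    using copula_volume[OF C, of u1 "max u1 u2" "max v1 v2" 1] copula_boundary[OF C, of u1]
      copula_boundary[OF C, of "max u1 u2"] assms
    by (simp add: max.coboundedI1)
  have 3: "C u1 (max v1 v2) \<le> C u1 v1 + (max v1 v2 - v1)"
    using copula_volume[OF C, of u1 1 v1 "max v1 v2"] copula_boundary[OF C, of v1] copula_boundary[OF C, of "max v1 v2"] assms
    by (simp add: max.coboundedI1)
  show ?thesis using 1 2 3 unfolding m by linarith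
qed

lemma copula_frechet:
  assumes C: "copula C" and "u \<in> {0..1}" "v \<in> {0..1}"
  shows "0 \<le> C u v" "u + v - 1 \<le> C u v" "C u v \<le> u" "C u v \<le> v"
proof -
  have uv: "0 \<le> u" "u \<le> 1" "0 \<le> v" "v \<le> 1" using assms by auto
  show "0 \<le> C u v" using copula_mono[OF C, of 0 u 0 v] copula_boundary(2)[OF C, of 0] uv by simp
  show "u + v - 1 \<le> C u v"
    using copula_volume[OF C, of u 1 v 1] copula_boundary(3)[OF C, of 1] copula_boundary(3)[OF C, of u]
      copula_boundary(4)[OF C, of v] uv by simp
  show "C u v \<le> u" using copula_mono[OF C, of u u v 1] copula_boundary(3)[OF C, of u] uv by simp
  show "C u v \<le> v" using copula_mono[OF C, of u 1 v v] copula_boundary(4)[OF C, of v] uv by simp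
qed

lemma copula_transpose:
  assumes C: "copula C" shows "copula (\<lambda>u v. C v u)"
proof (rule copulaI)
  fix u1 u2 v1 v2 :: real
  assume "0 \<le> u1" "u1 \<le> u2" "u2 \<le> 1" "0 \<le> v1" "v1 \<le> v2" "v2 \<le> 1"
  thus "C v2 u2 - C v1 u2 - C v2 u1 + C v1 u1 \<ge> 0"
    using copula_volume[OF C, of v1 v2 u1 u2] by simp
qed (use copula_boundary[OF C] in auto)

lemma copula_convex:
  assumes "copula A" "copula B" "0 \<le> s" "s \<le> (1::real)"
  shows "copula (\<lambda>u v. (1 - s) * A u v + s * B u v)"
proof (rule copulaI)
  fix u1 u2 v1 v2 :: real
  assume "0 \<le> u1" "u1 \<le> u2" "u2 \<le> 1" "0 \<le> v1" "v1 \<le> v2" "v2 \<le> 1"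
  hence "0 \<le> (1 - s) * (A u2 v2 - A u2 v1 - A u1 v2 + A u1 v1) + s * (B u2 v2 - B u2 v1 - B u1 v2 + B u1 v1)"
    using assms by (intro add_nonneg_nonneg mult_nonneg_nonneg copula_volume) auto
  thus "((1 - s) * A u2 v2 + s * B u2 v2) - ((1 - s) * A u2 v1 + s * B u2 v1)
     - ((1 - s) * A u1 v2 + s * B u1 v2) + ((1 - s) * A u1 v1 + s * B u1 v1) \<ge> 0"
    by (simp add: algebra_simps)
qed (simp_all add: copula_boundary[OF assms(1)] copula_boundary[OF assms(2)] left_diff_distrib)

text \<open>The second difference is the length of the common part of \<open>{a1..a2}\<close> and
  \<open>{b1..b2}\<close>. It is stated for numbers so that monotone functions of \<open>u\<close>
  and \<open>v\<close> can be substituted, which covers every increasing segment of a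
  shuffle.\<close>

lemma min_volume:
  fixes a1 a2 b1 b2 :: real
  assumes "a1 \<le> a2" "b1 \<le> b2"
  shows "min a2 b2 - min a2 b1 - min a1 b2 + min a1 b1 \<ge> 0"
  using assms by (simp add: min_def)

text \<open>Since \<open>max 0 (a + b - c) = a - min a (c - b)\<close>, this is
  \<open>min_volume\<close> for the reflected interval from \<open>c - b2\<close> to
  \<open>c - b1\<close>; it serves decreasing segments.\<close>

lemma max_volume:
  fixes a1 a2 b1 b2 c :: real
  assumes "a1 \<le> a2" "b1 \<le> b2"
  shows "max 0 (a2 + b2 - c) - max 0 (a2 + b1 - c) - max 0 (a1 + b2 - c) + max 0 (a1 + b1 - c) \<ge> 0"
  using assms by (simp add: max_def)

lemma copula_M: "copula copula_M"
  by (rule copulaI) (simp_all add: copula_M_def min_volume)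

lemma copula_W: "copula copula_W"
  by (rule copulaI) (simp_all add: copula_W_def max_volume)

text \<open>
  The mass of \<open>upper_copula d\<close> sits on the segments \<open>v = u + d\<close>, \<open>v = u - 2d\<close>, \<open>v = u\<close> over
  \<open>[0, 2d]\<close>, \<open>[2d, 3d]\<close>, \<open>[3d, 1]\<close>; that of \<open>lower_copula d\<close> on \<open>v = 1 - d - u\<close>, \<open>v = 1 + d - u\<close>,
  \<open>v = 1 - u\<close> over \<open>[0, d]\<close>, \<open>[d, 2d]\<close>, \<open>[2d, 1]\<close>. Each summand is one segment.
\<close>

definition upper_copula :: "real \<Rightarrow> real \<Rightarrow> real \<Rightarrow> real" where
  "upper_copula d u v = min (min u (2 * d)) (min (max 0 (v - d)) (2 * d))
     + min (min (max 0 (u - 2 * d)) d) (min v d) + min (max 0 (u - 3 * d)) (max 0 (v - 3 * d))"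

definition lower_copula :: "real \<Rightarrow> real \<Rightarrow> real \<Rightarrow> real" where
  "lower_copula d u v = max 0 (min u d + min (max 0 (v - (1 - 2 * d))) d - d)
     + max 0 (min (max 0 (u - d)) d + max 0 (v - (1 - d)) - d)
     + max 0 (max 0 (u - 2 * d) + min v (1 - 2 * d) - (1 - 2 * d))"

text \<open>The function variables allow the three segments of a shuffle to be named by
  instantiation and treated separately.\<close>

lemma volume_add3:
  fixes F1 F2 F3 :: "real \<Rightarrow> real \<Rightarrow> real"
  assumes "F1 u2 v2 - F1 u2 v1 - F1 u1 v2 + F1 u1 v1 \<ge> 0" "F2 u2 v2 - F2 u2 v1 - F2 u1 v2 + F2 u1 v1 \<ge> 0"
    "F3 u2 v2 - F3 u2 v1 - F3 u1 v2 + F3 u1 v1 \<ge> 0"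
  shows "(F1 u2 v2 + F2 u2 v2 + F3 u2 v2) - (F1 u2 v1 + F2 u2 v1 + F3 u2 v1)
    - (F1 u1 v2 + F2 u1 v2 + F3 u1 v2) + (F1 u1 v1 + F2 u1 v1 + F3 u1 v1) \<ge> 0"
  using assms by simp

text \<open>Every summand is a \<open>min\<close> of a monotone function of \<open>u\<close> and a
  monotone function of \<open>v\<close>, so \<open>min_volume\<close> applies to each. The margins
  are uniform because \<open>d \<le> 1/3\<close> keeps the permuted block \<open>[0, 3d]\<close>
  inside the unit interval.\<close>

lemma copula_upper_copula:
  assumes "0 \<le> d" "d \<le> 1/3"
  shows "copula (upper_copula d)"
proof (rule copulaI)
  fix u :: real assume "0 \<le> u" "u \<le> 1"
  with assms show "upper_copula d u 0 = 0" "upper_copula d 0 u = 0" "upper_copula d u 1 = u" "upper_copula d 1 u = u"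
    by (auto simp: upper_copula_def min_def max_def)
next
  fix u1 u2 v1 v2 :: real
  assume "0 \<le> u1" "u1 \<le> u2" "u2 \<le> 1" "0 \<le> v1" "v1 \<le> v2" "v2 \<le> 1"
  thus "upper_copula d u2 v2 - upper_copula d u2 v1 - upper_copula d u1 v2 + upper_copula d u1 v1 \<ge> 0"
    unfolding upper_copula_def
    by (intro volume_add3[where ?F1.0 = "\<lambda>u v. min (min u (2 * d)) (min (max 0 (v - d)) (2 * d))"
          and ?F2.0 = "\<lambda>u v. min (min (max 0 (u - 2 * d)) d) (min v d)"
          and ?F3.0 = "\<lambda>u v. min (max 0 (u - 3 * d)) (max 0 (v - 3 * d))"] min_volume min.mono max.mono)
      simp_all
qed

lemma copula_lower_copula:
  assumes "0 \<le> d" "d \<le> 1/3"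
  shows "copula (lower_copula d)"
proof (rule copulaI)
  fix u :: real assume "0 \<le> u" "u \<le> 1"
  with assms show "lower_copula d u 0 = 0" "lower_copula d 0 u = 0" "lower_copula d u 1 = u" "lower_copula d 1 u = u"
    by (auto simp: lower_copula_def min_def max_def)
next
  fix u1 u2 v1 v2 :: real
  assume "0 \<le> u1" "u1 \<le> u2" "u2 \<le> 1" "0 \<le> v1" "v1 \<le> v2" "v2 \<le> 1"
  thus "lower_copula d u2 v2 - lower_copula d u2 v1 - lower_copula d u1 v2 + lower_copula d u1 v1 \<ge> 0"
    unfolding lower_copula_def
    by (intro volume_add3[where ?F1.0 = "\<lambda>u v. max 0 (min u d + min (max 0 (v - (1 - 2 * d))) d - d)"
          and ?F2.0 = "\<lambda>u v. max 0 (min (max 0 (u - d)) d + max 0 (v - (1 - d)) - d)"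
          and ?F3.0 = "\<lambda>u v. max 0 (max 0 (u - 2 * d) + min v (1 - 2 * d) - (1 - 2 * d))"]
          max_volume min.mono max.mono) simp_all
qed

subsection \<open>The measure of a copula\<close>

definition lipschitz_cdf :: "(real \<Rightarrow> real) \<Rightarrow> bool" where
  "lipschitz_cdf F \<longleftrightarrow> mono F \<and> mono (\<lambda>x. x - F x)"

lemma lipschitz_cdf_continuous:
  assumes "lipschitz_cdf F"
  shows "continuous_on UNIV F"
proof (rule lipschitz_on_continuous_on[where L = 1], rule lipschitz_onI)
  fix x y :: real
  show "dist (F x) (F y) \<le> 1 * dist x y"
    using assms monoD[of F x y] monoD[of F y x] monoD[of "\<lambda>x. x - F x" x y] monoD[of "\<lambda>x. x - F x" y x]
    unfolding lipschitz_cdf_def dist_real_def by (cases "x \<le> y") auto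
qed simp

text \<open>Both sides are measures in \<open>A\<close> that agree on half-open intervals, hence on
  all Borel sets. With \<open>F\<close> and \<open>x - F x\<close> this splits Lebesgue measure into
  two parts.\<close>

lemma emeasure_interval_measure_add:
  assumes F: "mono F" "continuous_on UNIV F" and G: "mono G" "continuous_on UNIV G" and A: "A \<in> sets borel"
  shows "emeasure (interval_measure (\<lambda>x. F x + G x)) A
    = emeasure (interval_measure F) A + emeasure (interval_measure G) A"
proof -
  define \<mu> where "\<mu> = (\<lambda>A. emeasure (interval_measure F) A + emeasure (interval_measure G) A)"
  define N where "N = measure_of UNIV (sets borel) \<mu>"
  have sets_N: "sets N = sets borel"
    by (simp add: N_def sets.sigma_sets_eq[of borel, simplified])
  have "countably_additive (sets borel) \<mu>"
    unfolding countably_additive_def \<mu>_def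
    by (auto simp: suminf_add[symmetric] suminf_emeasure)
  hence N: "emeasure N A = \<mu> A" if "A \<in> sets borel" for A
    unfolding N_def using that sets.sigma_algebra_axioms[of borel]
    by (intro emeasure_measure_of_sigma) (auto simp: positive_def \<mu>_def)
  have Ioc: "emeasure (interval_measure (\<lambda>x. F x + G x)) {a<..b} = \<mu> {a<..b}" if "a \<le> b" for a b
  proof -
    have "F a \<le> F b" "G a \<le> G b" using F G that by (auto dest: monoD)
    thus ?thesis
      using that F G unfolding \<mu>_def
      by (subst (1 2 3) emeasure_interval_measure_Ioc)
        (auto simp: ennreal_plus[symmetric] simp del: ennreal_plus dest: monoD
          intro: add_mono continuous_on_imp_continuous_within continuous_on_subset intro!: continuous_intros
            simp: continuous_on_eq_continuous_at continuous_at_imp_continuous_within)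
  qed
  let ?E = "range (\<lambda>(a::real, b). {a<..b})"
  have "interval_measure (\<lambda>x. F x + G x) = N"
  proof (rule measure_eqI_generator_eq[where E = ?E and \<Omega> = UNIV and A = "\<lambda>i. {- real i<..real i}"])
    show "Int_stable ?E"
    proof (rule Int_stableI)
      fix a b assume "a \<in> ?E" "b \<in> ?E"
      then obtain x y x' y' where "a = {x<..y}" "b = {x'<..y'}" by auto
      hence "a \<inter> b = {max x x'<..min y y'}" by auto
      thus "a \<inter> b \<in> ?E" by auto
    qed
    show "emeasure (interval_measure (\<lambda>x. F x + G x)) X = emeasure N X" if "X \<in> ?E" for X
    proof -
      obtain a b where X: "X = {a<..b}" using \<open>X \<in> ?E\<close> by auto
      show ?thesis
        by (cases "a \<le> b") (simp_all add: X Ioc N \<mu>_def)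
    qed
    show "sets (interval_measure (\<lambda>x. F x + G x)) = sigma_sets UNIV ?E" "sets N = sigma_sets UNIV ?E"
      by (simp_all add: sets_N borel_sigma_sets_Ioc)
    show "(\<Union>i. {- real i<..real i}) = UNIV"
    proof (intro set_eqI iffI UNIV_I)
      fix x :: real
      obtain n where "\<bar>x\<bar> < real n" using reals_Archimedean2 by blast
      thus "x \<in> (\<Union>i. {- real i<..real i})" by (auto intro!: exI[of _ n])
    qed
    show "emeasure (interval_measure (\<lambda>x. F x + G x)) {- real i<..real i} \<noteq> \<infinity>" for i
      using F G by (subst emeasure_interval_measure_Ioc)
        (auto dest: monoD intro: add_mono intro!: continuous_intros
          simp: continuous_on_eq_continuous_at continuous_at_imp_continuous_within)
  qed auto
  thus ?thesis using N[OF A] by (simp add: \<mu>_def)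
qed

definition cdf_density :: "(real \<Rightarrow> real) \<Rightarrow> real \<Rightarrow> ennreal" where
  "cdf_density F = RN_deriv lborel (interval_measure F)"

lemma borel_measurable_cdf_density [measurable]: "cdf_density F \<in> borel_measurable borel"
  unfolding cdf_density_def using borel_measurable_RN_deriv[of lborel] by simp

text \<open>By the two halves of \<open>lipschitz_cdf\<close>, both \<open>F\<close> and
  \<open>x - F x\<close> define measures, and these add up to Lebesgue measure. Hence Lebesgue null
  sets are null for \<open>interval_measure F\<close>, and the Radon-Nikodym theorem
  applies.\<close>

lemma density_cdf_density:
  assumes F: "lipschitz_cdf F"
  shows "density lborel (cdf_density F) = interval_measure F"
proof -
  have G: "mono F" "continuous_on UNIV F" "mono (\<lambda>x. x - F x)" "continuous_on UNIV (\<lambda>x. x - F x)"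
    using F lipschitz_cdf_continuous[OF F] by (auto simp: lipschitz_cdf_def intro!: continuous_intros)
  have "emeasure (interval_measure F) A = 0" if "A \<in> null_sets lborel" for A
    using that emeasure_interval_measure_add[OF G, of A]
    by (auto simp: null_sets_def lborel_eq_real[symmetric])
  hence "absolutely_continuous lborel (interval_measure F)"
    by (auto simp: absolutely_continuous_def null_sets_def)
  thus ?thesis unfolding cdf_density_def
    by (rule sigma_finite_measure.density_RN_deriv[OF sigma_finite_lborel]) simp
qed

lemma nn_integral_cdf_density:
  assumes F: "lipschitz_cdf F" and "a \<le> b"
  shows "(\<integral>\<^sup>+x. cdf_density F x * indicator {a..b} x \<partial>lborel) = ennreal (F b - F a)"
proof -
  have "(\<integral>\<^sup>+x. cdf_density F x * indicator {a..b} x \<partial>lborel) = emeasure (density lborel (cdf_density F)) {a..b}"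
    by (simp add: emeasure_density)
  also have "\<dots> = ennreal (F b - F a)"
    unfolding density_cdf_density[OF F]
    using F assms(2) by (intro emeasure_interval_measure_Icc lipschitz_cdf_continuous)
      (auto simp: lipschitz_cdf_def dest: monoD)
  finally show ?thesis .
qed

lemma cdf_density_add:
  assumes F: "lipschitz_cdf F" and G: "lipschitz_cdf G" and FG: "lipschitz_cdf (\<lambda>x. F x + G x)"
  shows "AE x in lborel. cdf_density F x + cdf_density G x = cdf_density (\<lambda>x. F x + G x) x"
proof -
  have "density lborel (\<lambda>x. cdf_density F x + cdf_density G x) = interval_measure (\<lambda>x. F x + G x)"
  proof (rule measure_eqI)
    fix A assume "A \<in> sets (density lborel (\<lambda>x. cdf_density F x + cdf_density G x))"
    hence A [measurable]: "A \<in> sets borel" by simp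
    have "emeasure (density lborel (\<lambda>x. cdf_density F x + cdf_density G x)) A
        = emeasure (density lborel (cdf_density F)) A + emeasure (density lborel (cdf_density G)) A"
      by (simp add: emeasure_density distrib_right nn_integral_add)
    also have "\<dots> = emeasure (interval_measure (\<lambda>x. F x + G x)) A"
      using F G by (simp add: density_cdf_density emeasure_interval_measure_add lipschitz_cdf_def
        lipschitz_cdf_continuous[OF F] lipschitz_cdf_continuous[OF G])
    finally show "emeasure (density lborel (\<lambda>x. cdf_density F x + cdf_density G x)) A
        = emeasure (interval_measure (\<lambda>x. F x + G x)) A" .
  qed simp
  thus ?thesis
    unfolding cdf_density_def[of "\<lambda>x. F x + G x"] by (intro sigma_finite_measure.RN_deriv_unique[OF sigma_finite_lborel]) simp_all
qed

text \<open>By additivity the density of \<open>G\<close> exceeds that of \<open>F\<close> by the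
  density of \<open>G - F\<close>, which takes values in \<open>ennreal\<close>.\<close>

lemma cdf_density_mono:
  assumes "lipschitz_cdf F" "lipschitz_cdf G" "lipschitz_cdf (\<lambda>x. G x - F x)"
  shows "AE x in lborel. cdf_density F x \<le> cdf_density G x"
proof -
  have "AE x in lborel. cdf_density F x + cdf_density (\<lambda>x. G x - F x) x = cdf_density G x"
    using cdf_density_add[OF assms(1,3)] assms(2) by simp
  thus ?thesis
  proof (rule AE_mp, intro AE_I2 impI)
    fix x assume "cdf_density F x + cdf_density (\<lambda>x. G x - F x) x = cdf_density G x"
    from this[symmetric] show "cdf_density F x \<le> cdf_density G x" unfolding le_iff_add by blast
  qed
qed

lemma cdf_density_id: "AE x in lborel. cdf_density (\<lambda>x. x) x = 1"
proof -
  have "density lborel (\<lambda>_. 1) = interval_measure (\<lambda>x. x)"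
    by (simp add: density_1 lborel_eq_real[symmetric])
  from sigma_finite_measure.RN_deriv_unique[OF sigma_finite_lborel _ this] show ?thesis
    unfolding cdf_density_def by (auto elim!: eventually_mono)
qed

section \<open>Sections of a copula and conditional distributions\<close>

definition clip :: "real \<Rightarrow> real" where "clip x = max 0 (min 1 x)"

lemma clip_mem: "clip x \<in> {0..1}" by (simp add: clip_def)
lemma clip_eq: "x \<in> {0..1} \<Longrightarrow> clip x = x" by (simp add: clip_def)

text \<open>\<open>clip\<close> extends the section constantly beyond the unit interval, where
  \<open>C\<close> is unconstrained. An increment is the mass of a rectangle, which lies between
  \<open>0\<close> and its width. The difference of two sections is treated because
  \<open>cdf_density_mono\<close> needs it to compare the levels \<open>v1\<close> and
  \<open>v2\<close>.\<close>

lemma lipschitz_cdf_section: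
  assumes C: "copula C" and v: "0 \<le> v1" "v1 \<le> v2" "v2 \<le> 1"
  shows "lipschitz_cdf (\<lambda>x. C (clip x) v2 - C (clip x) v1)"
  unfolding lipschitz_cdf_def
proof (intro conjI monoI)
  fix x y :: real assume xy: "x \<le> y"
  hence c: "0 \<le> clip x" "clip x \<le> clip y" "clip y \<le> 1" "clip y - clip x \<le> y - x" by (auto simp: clip_def)
  show "C (clip x) v2 - C (clip x) v1 \<le> C (clip y) v2 - C (clip y) v1"
    using copula_volume[OF C c(1-3) v] by simp
  have "C (clip x) v1 \<le> C (clip y) v1" by (rule copula_mono[OF C]) (use c v in auto)
  moreover have "C (clip y) v2 \<le> C (clip x) v2 + max 0 (clip y - clip x) + max 0 (v2 - v2)"
    by (rule copula_lipschitz[OF C]) (use c v in auto)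
  ultimately show "x - (C (clip x) v2 - C (clip x) v1) \<le> y - (C (clip y) v2 - C (clip y) v1)"
    using c by simp
qed

lemma cdf_density_le_1:
  assumes "lipschitz_cdf F"
  shows "AE x in lborel. cdf_density F x \<le> 1"
proof -
  have "AE x in lborel. cdf_density F x \<le> cdf_density (\<lambda>x. x) x"
    using assms by (intro cdf_density_mono) (auto simp: lipschitz_cdf_def mono_def)
  with cdf_density_id show ?thesis by (rule AE_mp[OF AE_conjI]) auto
qed

text \<open>For a copula the density is at most \<open>1\<close> only almost everywhere. Truncation
  gives a real number in the unit interval at every point and changes the density only on a null
  set.\<close>

definition conditional_cdf :: "(real \<Rightarrow> real \<Rightarrow> real) \<Rightarrow> real \<Rightarrow> real \<Rightarrow> real" where
  "conditional_cdf C v x = enn2real (min 1 (cdf_density (\<lambda>x. C (clip x) v) x))"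

lemma borel_measurable_conditional_cdf [measurable]: "conditional_cdf C v \<in> borel_measurable borel"
  unfolding conditional_cdf_def by measurable

lemma conditional_cdf_bounds: "0 \<le> conditional_cdf C v x" "conditional_cdf C v x \<le> 1"
proof -
  have "enn2real (min 1 (cdf_density (\<lambda>x. C (clip x) v) x)) \<le> enn2real 1"
    by (rule enn2real_mono) auto
  thus "0 \<le> conditional_cdf C v x" "conditional_cdf C v x \<le> 1"
    by (simp_all add: conditional_cdf_def)
qed

lemma lipschitz_cdf_margin:
  assumes C: "copula C" and v: "v \<in> {0..1}"
  shows "lipschitz_cdf (\<lambda>x. C (clip x) v)"
  using lipschitz_cdf_section[OF C, of 0 v] v copula_boundary(1)[OF C] clip_mem by simp

lemma nn_integral_conditional_cdf:
  assumes C: "copula C" and a: "a \<in> {0..1}" and v: "v \<in> {0..1}"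
  shows "(\<integral>\<^sup>+x. ennreal (conditional_cdf C v x) * indicator {0..a} x \<partial>lborel) = ennreal (C a v)"
proof -
  have eq: "AE x in lborel. ennreal (conditional_cdf C v x) = cdf_density (\<lambda>x. C (clip x) v) x"
    using cdf_density_le_1[OF lipschitz_cdf_margin[OF C v]]
    by (rule AE_mp) (auto intro!: AE_I2 simp: conditional_cdf_def min_def ennreal_enn2real_if top_unique)
  have "(\<integral>\<^sup>+x. ennreal (conditional_cdf C v x) * indicator {0..a} x \<partial>lborel)
      = (\<integral>\<^sup>+x. cdf_density (\<lambda>x. C (clip x) v) x * indicator {0..a} x \<partial>lborel)"
    by (rule nn_integral_cong_AE, rule AE_mp[OF eq]) (auto intro!: AE_I2)
  also have "\<dots> = ennreal (C (clip a) v - C (clip 0) v)"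
    using nn_integral_cdf_density[OF lipschitz_cdf_margin[OF C v], of 0 a] a by simp
  also have "\<dots> = ennreal (C a v)"
    using a v copula_boundary(2)[OF C, of v] by (simp add: clip_eq)
  finally show ?thesis .
qed

lemma conditional_cdf_mono:
  assumes C: "copula C" and v: "0 \<le> v1" "v1 \<le> v2" "v2 \<le> 1"
  shows "AE x in lborel. conditional_cdf C v1 x \<le> conditional_cdf C v2 x"
proof -
  have "AE x in lborel. cdf_density (\<lambda>x. C (clip x) v1) x \<le> cdf_density (\<lambda>x. C (clip x) v2) x"
    using v by (intro cdf_density_mono lipschitz_cdf_margin[OF C] lipschitz_cdf_section[OF C]) auto
  thus ?thesis
    by (rule AE_mp)
      (auto intro!: AE_I2 enn2real_mono min.mono simp: conditional_cdf_def min_less_iff_disj)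
qed

text \<open>
  With \<open>conditional_cdf C v x = P(V \<le> v | U = x)\<close>, the map \<open>(x, t) \<mapsto> (x, conditional_quantile C x t)\<close>
  pushes Lebesgue measure on the unit square to \<open>dC\<close>. Only rational \<open>q\<close> enter the supremum, so
  the almost everywhere monotonicity of the densities in \<open>q\<close> is needed for countably many pairs only.
\<close>

definition conditional_quantile :: "(real \<Rightarrow> real \<Rightarrow> real) \<Rightarrow> real \<Rightarrow> real \<Rightarrow> real" where
  "conditional_quantile C x t = (SUP q\<in>\<rat> \<inter> {0..1}. if conditional_cdf C q x < t then q else 0)"

lemma conditional_quantile_bdd: "bdd_above ((\<lambda>q. if conditional_cdf C q x < t then q else 0) ` (\<rat> \<inter> {0..1}))"
  by (rule bdd_aboveI[where M = 1]) auto

text \<open>Indices that fail the test enter the supremum with the default \<open>0\<close>, which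
  is harmless for \<open>0 \<le> b\<close>. Only rationals strictly above \<open>b\<close> remain,
  so the condition sees the limit from the right at \<open>b\<close> instead of the value
  there.\<close>

lemma conditional_quantile_le_iff:
  assumes "0 \<le> b"
  shows "conditional_quantile C x t \<le> b \<longleftrightarrow> (\<forall>q\<in>\<rat> \<inter> {0..1}. b < q \<longrightarrow> t \<le> conditional_cdf C q x)"
proof -
  have "\<rat> \<inter> {0..1} \<noteq> ({} :: real set)" using Rats_0 by force
  thus ?thesis
    unfolding conditional_quantile_def using assms conditional_quantile_bdd
    by (subst cSUP_le_iff) (auto simp: not_less)
qed

lemma conditional_quantile_nonneg: "0 \<le> conditional_quantile C x t"
proof -
  have "(if conditional_cdf C 0 x < t then 0 else 0) \<le> conditional_quantile C x t"
    unfolding conditional_quantile_def by (rule cSUP_upper[OF _ conditional_quantile_bdd]) auto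
  thus ?thesis by simp
qed

lemma borel_measurable_conditional_quantile [measurable]:
  "(\<lambda>(x, t). conditional_quantile C x t) \<in> borel_measurable (lborel \<Otimes>\<^sub>M lborel)"
  unfolding conditional_quantile_def case_prod_beta
  by (rule borel_measurable_cSUP) (auto intro: countable_rat countable_subset[OF Int_lower1] conditional_quantile_bdd)

text \<open>The slice at \<open>x\<close> has length \<open>m x\<close>, which is at most
  \<open>conditional_cdf C q x\<close> for rational \<open>q > b\<close> and almost everywhere at
  least \<open>conditional_cdf C b x\<close>. Integration over \<open>{0..a}\<close> traps the mass
  between \<open>C a b\<close> and \<open>C a q\<close>, and \<open>q\<close> tends to
  \<open>b\<close> by the Lipschitz property.\<close>

lemma emeasure_conditional_quantile:
  assumes C: "copula C" and a: "a \<in> {0..1}" and b: "b \<in> {0..1}"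
  shows "emeasure (lborel \<Otimes>\<^sub>M lborel) {(x, t). x \<in> {0..a} \<and> t \<in> {0..1} \<and> conditional_quantile C x t \<le> b}
    = ennreal (C a b)"
proof -
  let ?S = "{(x, t). x \<in> {0..a} \<and> t \<in> {0..1} \<and> conditional_quantile C x t \<le> b}"
  have "{z \<in> space (lborel \<Otimes>\<^sub>M lborel). fst z \<in> {0..a} \<and> snd z \<in> {0..1} \<and>
      (\<lambda>(x, t). conditional_quantile C x t) z \<le> b} \<in> sets (lborel \<Otimes>\<^sub>M lborel)"
    by measurable
  also have "{z \<in> space (lborel \<Otimes>\<^sub>M lborel). fst z \<in> {0..a} \<and> snd z \<in> {0..1} \<and>
      (\<lambda>(x, t). conditional_quantile C x t) z \<le> b} = ?S"
    by (auto simp: space_pair_measure)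
  finally have S: "?S \<in> sets (lborel \<Otimes>\<^sub>M lborel)" .
  define m where "m x = emeasure lborel {t \<in> {0..1}. conditional_quantile C x t \<le> b}" for x
  have slice: "{t \<in> {0..1}. conditional_quantile C x t \<le> b} \<in> sets lborel" for x
  proof -
    have "(\<lambda>t. (\<lambda>(x, t). conditional_quantile C x t) (x, t)) \<in> borel_measurable lborel"
      by measurable
    hence [measurable]: "conditional_quantile C x \<in> borel_measurable borel" by simp
    show ?thesis by measurable
  qed
  have "emeasure (lborel \<Otimes>\<^sub>M lborel) ?S = (\<integral>\<^sup>+x. emeasure lborel (Pair x -` ?S) \<partial>lborel)"
    by (rule lborel.emeasure_pair_measure_alt[OF S])
  also have "\<dots> = (\<integral>\<^sup>+x. m x * indicator {0..a} x \<partial>lborel)"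
    by (intro nn_integral_cong) (auto simp: m_def indicator_def intro!: arg_cong[where f = "emeasure lborel"])
  finally have E: "emeasure (lborel \<Otimes>\<^sub>M lborel) ?S = (\<integral>\<^sup>+x. m x * indicator {0..a} x \<partial>lborel)" .
  have upper: "(\<integral>\<^sup>+x. m x * indicator {0..a} x \<partial>lborel) \<le> ennreal (C a q)" if q: "q \<in> \<rat>" "b < q" "q \<le> 1" for q
  proof -
    have "m x \<le> ennreal (conditional_cdf C q x)" for x
    proof -
      have "m x \<le> emeasure lborel {0..conditional_cdf C q x}"
        unfolding m_def using q b conditional_quantile_le_iff[of b C x]
        by (intro emeasure_mono) auto
      thus ?thesis by (simp add: conditional_cdf_bounds)
    qed
    hence "(\<integral>\<^sup>+x. m x * indicator {0..a} x \<partial>lborel)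
        \<le> (\<integral>\<^sup>+x. ennreal (conditional_cdf C q x) * indicator {0..a} x \<partial>lborel)"
      by (intro nn_integral_mono mult_right_mono) auto
    thus ?thesis using nn_integral_conditional_cdf[OF C a, of q] q b by simp
  qed
  have "AE x in lborel. \<forall>q\<in>\<rat> \<inter> {0..1}. b < q \<longrightarrow> conditional_cdf C b x \<le> conditional_cdf C q x"
    using b by (intro AE_ball_countable[THEN iffD2] countable_subset[OF Int_lower1 countable_rat] ballI)
      (auto intro!: AE_impI conditional_cdf_mono[OF C])
  hence "AE x in lborel. ennreal (conditional_cdf C b x) \<le> m x"
  proof (rule AE_mp, intro AE_I2 impI)
    fix x assume *: "\<forall>q\<in>\<rat> \<inter> {0..1}. b < q \<longrightarrow> conditional_cdf C b x \<le> conditional_cdf C q x"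
    have "{0..conditional_cdf C b x} \<subseteq> {t \<in> {0..1}. conditional_quantile C x t \<le> b}"
    proof
      fix t assume "t \<in> {0..conditional_cdf C b x}"
      thus "t \<in> {t \<in> {0..1}. conditional_quantile C x t \<le> b}"
        using * b conditional_cdf_bounds(2)[of C b x] by (auto simp: conditional_quantile_le_iff intro: order_trans)
    qed
    from emeasure_mono[OF this slice] show "ennreal (conditional_cdf C b x) \<le> m x"
      by (simp add: m_def conditional_cdf_bounds)
  qed
  hence "(\<integral>\<^sup>+x. ennreal (conditional_cdf C b x) * indicator {0..a} x \<partial>lborel)
      \<le> (\<integral>\<^sup>+x. m x * indicator {0..a} x \<partial>lborel)"
    by (intro nn_integral_mono_AE, elim eventually_mono) (rule mult_right_mono, simp_all)
  hence lower: "ennreal (C a b) \<le> (\<integral>\<^sup>+x. m x * indicator {0..a} x \<partial>lborel)"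
    using nn_integral_conditional_cdf[OF C a b] by simp
  have "m x \<le> 1" for x
  proof -
    have "m x \<le> emeasure lborel {0..1::real}" unfolding m_def by (rule emeasure_mono) auto
    thus ?thesis by simp
  qed
  hence "(\<integral>\<^sup>+x. m x * indicator {0..a} x \<partial>lborel) \<le> (\<integral>\<^sup>+x. 1 * indicator {0..a} x \<partial>lborel)"
    by (intro nn_integral_mono mult_right_mono) auto
  hence total: "(\<integral>\<^sup>+x. m x * indicator {0..a} x \<partial>lborel) \<le> ennreal a"
    using a by simp
  have "(\<integral>\<^sup>+x. m x * indicator {0..a} x \<partial>lborel) \<le> ennreal (C a b)"
  \<comment> \<open>No \<open>q\<close> in the unit interval lies above \<open>1\<close>; there the
    trivial bound \<open>m x \<le> 1\<close> already gives \<open>a = C a 1\<close>.\<close>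
  proof (cases "b = 1")
    case True
    thus ?thesis using total copula_boundary(3)[OF C, of a] a by simp
  next
    case False
    hence b1: "b < 1" using b by simp
    show ?thesis
    proof (rule ennreal_le_epsilon)
      fix e :: real assume e: "0 < e"
      obtain q where q: "q \<in> \<rat>" "b < q" "q < min 1 (b + e)" using Rats_dense_in_real[of b "min 1 (b + e)"] b1 e by auto
      have "C a q \<le> C a b + e" using copula_lipschitz[OF C a a b, of q] q b by auto
      moreover have "0 \<le> C a b" using copula_frechet(1)[OF C a b] .
      ultimately have "ennreal (C a q) \<le> ennreal (C a b) + ennreal e"
        using e by (simp add: ennreal_plus[symmetric] ennreal_leI del: ennreal_plus)
      with upper[of q] q show "(\<integral>\<^sup>+x. m x * indicator {0..a} x \<partial>lborel) \<le> ennreal (C a b) + ennreal e"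
        by (auto intro: order_trans)
    qed
  qed
  with lower E show ?thesis by simp
qed

section \<open>The mass of boxes under \<open>copula_measure\<close>\<close>

lemma copula_boxes_subset:
  "(\<lambda>(u :: real, v :: real). {0..u} \<times> {0..v}) ` ({0..1} \<times> {0..1}) \<subseteq> Pow ({0..1} \<times> {0..1})"
  by auto

lemma space_copula_measure: "space (copula_measure C) = {0..1} \<times> {0..1}"
  unfolding copula_measure_def by (rule space_extend_measure[OF copula_boxes_subset])

lemma sets_copula_measure: "sets (copula_measure C) =
    sigma_sets ({0..1} \<times> {0..1}) ((\<lambda>(u, v). {0..u} \<times> {0..v}) ` ({0..1} \<times> {0..1}))"
  unfolding copula_measure_def by (rule sets_extend_measure[OF copula_boxes_subset])

text \<open>\<open>extend_measure\<close> takes the prescribed values only if some measure has them.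
  The witness \<open>\<mu>\<close> is the image of Lebesgue measure on the square under the quantile
  map \<open>?T\<close>.\<close>

lemma emeasure_copula_measure:
  assumes C: "copula C" and u: "u \<in> {0..1}" and v: "v \<in> {0..1}"
  shows "emeasure (copula_measure C) ({0..u} \<times> {0..v}) = ennreal (C u v)"
proof -
  let ?G = "\<lambda>(u::real, v::real). {0..u} \<times> {0..v}" and ?I = "{0..1::real} \<times> {0..1::real}"
  let ?T = "\<lambda>(x, t). (x, conditional_quantile C x t)"
  let ?L = "lborel \<Otimes>\<^sub>M lborel :: (real \<times> real) measure"
  define \<mu> where "\<mu> A = emeasure ?L (?T -` A \<inter> ?I)" for A
  have borel: "A \<in> sets borel" if "A \<in> sets (copula_measure C)" for A
    using that unfolding sets_copula_measure
  proof induct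
    case (Basic a)
    then obtain u v where "a = {0..u} \<times> {0..v}" by auto
    thus ?case by (simp only:) (intro borel_closed closed_Times closed_atLeastAtMost)
  next
    case (Compl a)
    have "?I \<in> sets borel" by (intro borel_closed closed_Times closed_atLeastAtMost)
    from sets.Diff[OF this Compl(2)] show ?case .
  next
    case (Union a)
    hence "range a \<subseteq> sets borel" by auto
    from sets.countable_UN[OF this] show ?case .
  qed simp
  have T: "?T \<in> ?L \<rightarrow>\<^sub>M borel"
  proof -
    have "(\<lambda>z. (fst z, (\<lambda>(x, t). conditional_quantile C x t) z)) \<in> ?L \<rightarrow>\<^sub>M borel \<Otimes>\<^sub>M borel"
      by measurable
    thus ?thesis by (simp add: borel_prod case_prod_beta')
  qed
  have I: "?I \<in> sets ?L" by auto
  have space_L: "space ?L = UNIV" by (simp add: space_pair_measure)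
  have meas: "?T -` A \<inter> ?I \<in> sets ?L" if "A \<in> sets (copula_measure C)" for A
    using sets.Int[OF measurable_sets[OF T borel[OF that]] I] by (simp only: space_L Int_UNIV_right)
  have "countably_additive (sets (copula_measure C)) \<mu>"
    unfolding countably_additive_def
  proof (intro allI impI)
    fix A :: "nat \<Rightarrow> (real \<times> real) set"
    assume A: "range A \<subseteq> sets (copula_measure C)" "disjoint_family A"
    have "(\<Sum>i. emeasure ?L (?T -` A i \<inter> ?I)) = emeasure ?L (\<Union>i. ?T -` A i \<inter> ?I)"
      using A meas by (intro suminf_emeasure) (auto simp: disjoint_family_on_def)
    also have "(\<Union>i. ?T -` A i \<inter> ?I) = ?T -` (\<Union>i. A i) \<inter> ?I" by auto
    finally show "(\<Sum>i. \<mu> (A i)) = \<mu> (\<Union>i. A i)" by (simp add: \<mu>_def)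
  qed
  moreover have "\<mu> (?G i) = (\<lambda>(u, v). ennreal (C u v)) i" if "i \<in> ?I" for i
  proof -
    obtain a b where i: "i = (a, b)" "a \<in> {0..1}" "b \<in> {0..1}" using \<open>i \<in> ?I\<close> by auto
    \<comment> \<open>The lower edge of the box imposes no condition, as quantiles are
      nonnegative.\<close>
    have "?T -` ?G i \<inter> ?I = {(x, t). x \<in> {0..a} \<and> t \<in> {0..1} \<and> conditional_quantile C x t \<le> b}"
      using i by (auto simp: conditional_quantile_nonneg)
    thus ?thesis using emeasure_conditional_quantile[OF C i(2,3)] by (simp add: \<mu>_def i(1))
  qed
  moreover have "positive (sets (copula_measure C)) \<mu>" by (simp add: positive_def \<mu>_def)
  moreover have "(u, v) \<in> ?I" using u v by simp
  ultimately have "emeasure (copula_measure C) (?G (u, v)) = (\<lambda>(u, v). ennreal (C u v)) (u, v)"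
    by (intro emeasure_extend_measure[OF copula_measure_def _ copula_boxes_subset])
  thus ?thesis by simp
qed

subsection \<open>Gini's gamma as an integral over the two diagonals\<close>

lemma integral_hinge:
  fixes c :: real assumes "0 \<le> c" "c \<le> 1"
  shows "((\<lambda>u. max 0 (u - c)) has_integral (1 - c)^2 / 2) {0..1}"
proof -
  have "((\<lambda>u. max 0 (u - c)) has_integral 0) {0..c}"
    by (rule has_integral_eq[OF _ has_integral_0]) auto
  moreover have "((\<lambda>u. u - c) has_integral (1 - c)^2 / 2 - (c - c)^2 / 2) {c..1}"
    by (rule fundamental_theorem_of_calculus)
      (use assms in \<open>auto intro!: derivative_eq_intros simp: has_real_derivative_iff_has_vector_derivative[symmetric]\<close>)
  hence "((\<lambda>u. max 0 (u - c)) has_integral (1 - c)^2 / 2) {c..1}"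
    by (subst has_integral_cong[of _ _ "\<lambda>u. u - c"]) simp_all
  ultimately have "((\<lambda>u. max 0 (u - c)) has_integral 0 + (1 - c)^2 / 2) {0..1}"
    by (rule has_integral_combine[OF assms])
  thus ?thesis by simp
qed

text \<open>A list of pairs (change of slope \<open>k\<close>, breakpoint \<open>c\<close>) encodes
  a continuous piecewise linear function vanishing at \<open>0\<close>. All integrals along the
  diagonals are evaluated or estimated through such lists.\<close>

lemma integral_hinges:
  assumes "\<And>k c. (k, c) \<in> set xs \<Longrightarrow> 0 \<le> c \<and> c \<le> (1::real)"
  shows "((\<lambda>u. \<Sum>(k, c)\<leftarrow>xs. k * max 0 (u - c)) has_integral (\<Sum>(k, c)\<leftarrow>xs. k * ((1 - c)\<^sup>2 / 2))) {0..1}"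
  using assms
proof (induction xs)
  case (Cons x xs)
  obtain k c where x: "x = (k, c)" by (cases x)
  hence 1: "((\<lambda>u. k * max 0 (u - c)) has_integral k * ((1 - c)\<^sup>2 / 2)) {0..1}"
    using Cons.prems by (intro has_integral_mult_right integral_hinge) auto
  have 2: "((\<lambda>u. \<Sum>(k, c)\<leftarrow>xs. k * max 0 (u - c)) has_integral (\<Sum>(k, c)\<leftarrow>xs. k * ((1 - c)\<^sup>2 / 2))) {0..1}"
    by (rule Cons.IH, rule Cons.prems) auto
  show ?case using has_integral_add[OF 1 2] by (simp add: x)
qed simp

lemma integral_eq_hinges:
  assumes "\<And>u. 0 \<le> u \<Longrightarrow> u \<le> 1 \<Longrightarrow> f u = (\<Sum>(k, c)\<leftarrow>xs. k * max 0 (u - c))"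
    and "\<And>k c. (k, c) \<in> set xs \<Longrightarrow> 0 \<le> c \<and> c \<le> (1::real)"
  shows "integral {0..1} f = (\<Sum>(k, c)\<leftarrow>xs. k * ((1 - c)\<^sup>2 / 2))"
  using integral_cong[of "{0..1}" f] assms(1) integral_unique[OF integral_hinges[OF assms(2)]] by auto

lemma integral_le_hinges:
  assumes "f integrable_on {0..1}" "\<And>u. 0 \<le> u \<Longrightarrow> u \<le> 1 \<Longrightarrow> f u \<le> (\<Sum>(k, c)\<leftarrow>xs. k * max 0 (u - c))"
    and "\<And>k c. (k, c) \<in> set xs \<Longrightarrow> 0 \<le> c \<and> c \<le> (1::real)"
  shows "integral {0..1} f \<le> (\<Sum>(k, c)\<leftarrow>xs. k * ((1 - c)\<^sup>2 / 2))"
  using has_integral_le[OF integrable_integral[OF assms(1)] integral_hinges[OF assms(3)]] assms(2) by simp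

lemma integral_ge_hinges:
  assumes "f integrable_on {0..1}" "\<And>u. 0 \<le> u \<Longrightarrow> u \<le> 1 \<Longrightarrow> (\<Sum>(k, c)\<leftarrow>xs. k * max 0 (u - c)) \<le> f u"
    and "\<And>k c. (k, c) \<in> set xs \<Longrightarrow> 0 \<le> c \<and> c \<le> (1::real)"
  shows "(\<Sum>(k, c)\<leftarrow>xs. k * ((1 - c)\<^sup>2 / 2)) \<le> integral {0..1} f"
  using has_integral_le[OF integral_hinges[OF assms(3)] integrable_integral[OF assms(1)]] assms(2) by simp

lemma hinge_eq:
  fixes u c :: real
  shows "c \<le> u \<Longrightarrow> max 0 (u - c) = u - c" "u \<le> c \<Longrightarrow> max 0 (u - c) = 0"
  by auto

lemma copula_abs_lipschitz:
  assumes "copula C" "u1 \<in> {0..1}" "u2 \<in> {0..1}" "v1 \<in> {0..1}" "v2 \<in> {0..1}"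
  shows "\<bar>C u2 v2 - C u1 v1\<bar> \<le> \<bar>u2 - u1\<bar> + \<bar>v2 - v1\<bar>"
  using copula_lipschitz[OF assms] copula_lipschitz[of C u2 u1 v2 v1] assms by linarith

lemma continuous_on_diagonal:
  assumes "copula C" shows "continuous_on {0..1} (\<lambda>t. C t t)"
proof (rule lipschitz_on_continuous_on[where L = 2], rule lipschitz_onI)
  fix x y :: real assume "x \<in> {0..1}" "y \<in> {0..1}"
  from copula_abs_lipschitz[OF assms this(2,1) this(2,1)] show "dist (C x x) (C y y) \<le> 2 * dist x y"
    by (simp add: dist_real_def)
qed simp

lemma continuous_on_antidiagonal:
  assumes "copula C" shows "continuous_on {0..1} (\<lambda>t. C t (1 - t))"
proof (rule lipschitz_on_continuous_on[where L = 2], rule lipschitz_onI)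
  fix x y :: real assume xy: "x \<in> {0..1}" "y \<in> {0..1}"
  hence "1 - x \<in> {0..1}" "1 - y \<in> {0..1}" by auto
  from copula_abs_lipschitz[OF assms xy(2,1) this(2,1)] show "dist (C x (1 - x)) (C y (1 - y)) \<le> 2 * dist x y"
    by (simp add: dist_real_def abs_minus_commute)
qed simp

lemmas diagonal_integrable = integrable_continuous_real[OF continuous_on_diagonal]
lemmas antidiagonal_integrable = integrable_continuous_real[OF continuous_on_antidiagonal]

section \<open>Integration against \<open>dC\<close>\<close>

lemma box_in_copula_measure:
  "u \<in> {0..1} \<Longrightarrow> v \<in> {0..1} \<Longrightarrow> {0..u} \<times> {0..v} \<in> sets (copula_measure C)"
  unfolding sets_copula_measure by (rule sigma_sets.Basic) force

text \<open>The sigma algebra is known only through its generating boxes, but the sublevel sets of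
  both coordinates are themselves boxes or empty.\<close>

lemma borel_measurable_copula_measure:
  "fst \<in> borel_measurable (copula_measure C)" "snd \<in> borel_measurable (copula_measure C)"
proof -
  have "{z \<in> space (copula_measure C). fst z \<le> a} \<in> sets (copula_measure C) \<and>
      {z \<in> space (copula_measure C). snd z \<le> a} \<in> sets (copula_measure C)" for a
  proof (cases "0 \<le> a")
    case True
    have "{z \<in> space (copula_measure C). fst z \<le> a} = {0..min a 1} \<times> {0..1}"
      "{z \<in> space (copula_measure C). snd z \<le> a} = {0..1} \<times> {0..min a 1}"
      by (auto simp: space_copula_measure)
    thus ?thesis using box_in_copula_measure[of "min a 1" 1] box_in_copula_measure[of 1 "min a 1"] True by simp
  next
    case False
    hence "{z \<in> space (copula_measure C). fst z \<le> a} = {}" "{z \<in> space (copula_measure C). snd z \<le> a} = {}"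
      by (auto simp: space_copula_measure)
    thus ?thesis by (simp only: sets.empty_sets simp_thms)
  qed
  thus "fst \<in> borel_measurable (copula_measure C)" "snd \<in> borel_measurable (copula_measure C)"
    by (simp_all add: borel_measurable_iff_le)
qed

lemma finite_measure_copula_measure:
  assumes C: "copula C"
  shows "finite_measure (copula_measure C)"
  using emeasure_copula_measure[OF C, of 1 1] by (intro finite_measureI) (simp add: space_copula_measure)

text \<open>This is the survival function of \<open>C\<close>, found by inclusion-exclusion for the
  complement of two boxes.\<close>

lemma emeasure_copula_measure_upper:
  assumes C: "copula C" and s: "s \<in> {0..1}" and t: "t \<in> {0..1}"
  shows "emeasure (copula_measure C) {z \<in> space (copula_measure C). t < fst z \<and> s < snd z} = ennreal (1 - t - s + C t s)"
proof -
  interpret finite_measure "copula_measure C" by (rule finite_measure_copula_measure[OF C])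
  have box: "measure (copula_measure C) ({0..u} \<times> {0..v}) = C u v" if "u \<in> {0..1}" "v \<in> {0..1}" for u v
    using emeasure_copula_measure[OF C that] copula_frechet(1)[OF C that] by (simp add: measure_def)
  let ?A = "{0..t} \<times> {0..1::real}" and ?B = "{0..1::real} \<times> {0..s}"
  have sets: "?A \<in> sets (copula_measure C)" "?B \<in> sets (copula_measure C)"
    using s t by (intro box_in_copula_measure; simp)+
  have "?A \<inter> ?B = {0..t} \<times> {0..s}" using s t by auto
  hence "measure (copula_measure C) (?A \<union> ?B) = t + s - C t s"
    using sets s t copula_boundary(3)[OF C, of t] copula_boundary(4)[OF C, of s]
    by (subst measure_Un3) (simp_all add: box fmeasurable_eq_sets)
  moreover have "measure (copula_measure C) (space (copula_measure C)) = 1"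
    using box[of 1 1] copula_boundary(3)[OF C, of 1] by (simp add: space_copula_measure)
  moreover have "{z \<in> space (copula_measure C). t < fst z \<and> s < snd z} = space (copula_measure C) - (?A \<union> ?B)"
    by (auto simp: space_copula_measure)
  ultimately have "measure (copula_measure C) {z \<in> space (copula_measure C). t < fst z \<and> s < snd z} = 1 - t - s + C t s"
    using finite_measure_compl[of "?A \<union> ?B"] sets by simp
  thus ?thesis by (simp add: emeasure_eq_measure)
qed

text \<open>Fubini: integrate over \<open>t\<close> the \<open>dC\<close>-mass of the points \<open>(u, v)\<close> with \<open>t < u\<close> and \<open>s t < v\<close>.\<close>

lemma integral_copula_measure:
  assumes C: "copula C" and s [measurable]: "s \<in> borel_measurable borel" and s01: "\<And>t. t \<in> {0..1} \<Longrightarrow> s t \<in> {0..1}"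
    and int: "(\<lambda>t. 1 - t - s t + C t (s t)) integrable_on {0..1}"
    and f: "f \<in> borel_measurable (copula_measure C)" "\<And>z. 0 \<le> f z"
    and f_eq: "\<And>z. z \<in> {0..1} \<times> {0..1} \<Longrightarrow> emeasure lborel {t \<in> {0..1}. t < fst z \<and> s t < snd z} = ennreal (f z)"
  shows "(LINT z|copula_measure C. f z) = integral {0..1} (\<lambda>t. 1 - t - s t + C t (s t))"
proof -
  let ?M = "copula_measure C"
  interpret M: finite_measure ?M by (rule finite_measure_copula_measure[OF C])
  interpret pair_sigma_finite ?M lborel ..
  let ?S = "{p \<in> space (?M \<Otimes>\<^sub>M lborel). snd p \<in> {0..1} \<and> snd p < fst (fst p) \<and> s (snd p) < snd (fst p)}"
  note [measurable] = borel_measurable_copula_measure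
  have S: "?S \<in> sets (?M \<Otimes>\<^sub>M lborel)" by measurable
  have nonneg: "0 \<le> 1 - t - s t + C t (s t)" if "t \<in> {0..1}" for t
    using copula_frechet(2)[OF C that s01[OF that]] by simp
  have "(\<integral>\<^sup>+z. ennreal (f z) \<partial>?M) = (\<integral>\<^sup>+z. emeasure lborel (Pair z -` ?S) \<partial>?M)"
    by (intro nn_integral_cong)
      (auto simp: f_eq[symmetric] space_copula_measure space_pair_measure intro!: arg_cong[where f = "emeasure lborel"])
  also have "\<dots> = emeasure (?M \<Otimes>\<^sub>M lborel) ?S"
    by (rule lborel.emeasure_pair_measure_alt[OF S, symmetric])
  also have "\<dots> = (\<integral>\<^sup>+t. emeasure ?M ((\<lambda>z. (z, t)) -` ?S) \<partial>lborel)"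
    by (rule emeasure_pair_measure_alt2[OF S])
  also have "\<dots> = (\<integral>\<^sup>+t. ennreal (1 - t - s t + C t (s t)) * indicator {0..1} t \<partial>lborel)"
  proof (intro nn_integral_cong)
    fix t :: real
    show "emeasure ?M ((\<lambda>z. (z, t)) -` ?S) = ennreal (1 - t - s t + C t (s t)) * indicator {0..1} t"
    proof (cases "t \<in> {0..1}")
      case True
      hence "(\<lambda>z. (z, t)) -` ?S = {z \<in> space ?M. t < fst z \<and> s t < snd z}"
        by (auto simp: space_pair_measure)
      thus ?thesis using True emeasure_copula_measure_upper[OF C s01[OF True] True] by simp
    next
      case False
      hence "(\<lambda>z. (z, t)) -` ?S = {}" by auto
      thus ?thesis using False by (simp only: emeasure_empty) simp
    qed
  qed
  also have "\<dots> = ennreal (integral {0..1} (\<lambda>t. 1 - t - s t + C t (s t)))"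
    using nonneg int by (intro nn_integral_has_integral_lebesgue' integrable_integral) auto
  finally have "(\<integral>\<^sup>+z. ennreal (f z) \<partial>?M) = ennreal (integral {0..1} (\<lambda>t. 1 - t - s t + C t (s t)))" .
  moreover have "0 \<le> integral {0..1} (\<lambda>t. 1 - t - s t + C t (s t))"
    using nonneg int by (intro integral_nonneg) auto
  ultimately show ?thesis using f by (simp add: integral_eq_nn_integral)
qed

text \<open>With \<open>s t = t\<close> the set of admissible \<open>t\<close> is an interval of
  length \<open>min u v\<close>. The part \<open>1 - 2 * t\<close> of the survival function
  integrates to \<open>0\<close>.\<close>

lemma integral_copula_M:
  assumes C: "copula C" and int: "(\<lambda>t. C t t) integrable_on {0..1}"
  shows "(LINT (u, v)|copula_measure C. copula_M u v) = integral {0..1} (\<lambda>t. C t t)"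
proof -
  have "((\<lambda>t::real. 1 - 2 * t) has_integral (1 - 1\<^sup>2) - (0 - 0\<^sup>2)) {0..1}"
    by (rule fundamental_theorem_of_calculus[where f = "\<lambda>t. t - t\<^sup>2"])
      (auto intro!: derivative_eq_intros simp: has_real_derivative_iff_has_vector_derivative[symmetric])
  hence id: "((\<lambda>t::real. 1 - 2 * t) has_integral 0) {0..1}" by simp
  have "(\<lambda>t. 1 - t - t + C t t) = (\<lambda>t. (1 - 2 * t) + C t t)" by auto
  hence M_int: "((\<lambda>t. 1 - t - t + C t t) has_integral integral {0..1} (\<lambda>t. C t t)) {0..1}"
    using has_integral_add[OF id integrable_integral[OF int]] by (simp only: add_0)
  \<comment> \<open>The outer \<open>max 0\<close> changes nothing on the square but makes the
    integrand nonnegative everywhere, as \<open>integral_copula_measure\<close> requires.\<close>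
  have "(LINT z|copula_measure C. max 0 (min (fst z) (snd z))) = integral {0..1} (\<lambda>t. 1 - t - t + C t t)"
  proof (rule integral_copula_measure[OF C])
    show "(\<lambda>t. 1 - t - t + C t t) integrable_on {0..1}" using M_int by (rule has_integral_integrable)
    show "(\<lambda>z. max 0 (min (fst z) (snd z))) \<in> borel_measurable (copula_measure C)"
      by (intro borel_measurable_max borel_measurable_min borel_measurable_const borel_measurable_copula_measure)
    fix z :: "real \<times> real" assume z: "z \<in> {0..1} \<times> {0..1}"
    hence eq: "{t \<in> {0..1}. t < fst z \<and> t < snd z} = {0..<min (fst z) (snd z)}" by auto
    have "0 \<le> min (fst z) (snd z)" using z by auto
    thus "emeasure lborel {t \<in> {0..1}. t < fst z \<and> t < snd z} = ennreal (max 0 (min (fst z) (snd z)))"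
      unfolding eq by simp
  qed simp_all
  moreover have "(LINT z|copula_measure C. max 0 (min (fst z) (snd z))) =
      (LINT (u, v)|copula_measure C. copula_M u v)"
    by (intro Bochner_Integration.integral_cong) (auto simp: space_copula_measure copula_M_def)
  ultimately show ?thesis
    using integral_unique[OF M_int] by simp
qed

text \<open>With \<open>s t = 1 - t\<close> the admissible \<open>t\<close> fill the interval from
  \<open>1 - v\<close> to \<open>u\<close>, and the linear part of the survival function
  cancels.\<close>

lemma integral_copula_W:
  assumes C: "copula C" and int: "(\<lambda>t. C t (1 - t)) integrable_on {0..1}"
  shows "(LINT (u, v)|copula_measure C. copula_W u v) = integral {0..1} (\<lambda>t. C t (1 - t))"
proof -
  have "(LINT z|copula_measure C. max 0 (fst z + snd z - 1)) = integral {0..1} (\<lambda>t. 1 - t - (1 - t) + C t (1 - t))"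
  proof (rule integral_copula_measure[OF C])
    show "(\<lambda>t. 1 - t - (1 - t) + C t (1 - t)) integrable_on {0..1}" using int by simp
    show "(\<lambda>z. max 0 (fst z + snd z - 1)) \<in> borel_measurable (copula_measure C)"
      by (intro borel_measurable_max borel_measurable_diff borel_measurable_add borel_measurable_const
        borel_measurable_copula_measure)
    fix z :: "real \<times> real" assume z: "z \<in> {0..1} \<times> {0..1}"
    hence eq: "{t \<in> {0..1}. t < fst z \<and> 1 - t < snd z} = {1 - snd z<..<fst z}" by auto
    show "emeasure lborel {t \<in> {0..1}. t < fst z \<and> 1 - t < snd z} = ennreal (max 0 (fst z + snd z - 1))"
      unfolding eq by (cases "1 - snd z \<le> fst z") (simp_all add: max_def algebra_simps)
  qed simp_all
  thus ?thesis by (simp add: case_prod_beta' copula_W_def)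
qed

lemma gini_gamma_eq:
  assumes C: "copula C"
  shows "gini_gamma C = 4 * (integral {0..1} (\<lambda>t. C t t) + integral {0..1} (\<lambda>t. C t (1 - t))) - 2"
  unfolding gini_gamma_def concordance_def
  by (simp add: integral_copula_M integral_copula_W C diagonal_integrable antidiagonal_integrable)

subsection \<open>Bounds in terms of the asymmetry\<close>

lemma asymmetry_constraints:
  assumes C: "copula C" and ab: "0 \<le> a" "a \<le> b" "b \<le> 1"
  shows "C a b - C b a \<le> a" "C a b - C b a \<le> b - a" "C a b - C b a \<le> 1 - b"
proof -
  have mem: "a \<in> {0..1}" "b \<in> {0..1}" using ab by auto
  show "C a b - C b a \<le> a" "C a b - C b a \<le> 1 - b"
    using copula_frechet[OF C mem] copula_frechet[OF C mem(2,1)] by auto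
  \<comment> \<open>Passing from \<open>(b, a)\<close> to \<open>(a, b)\<close> lowers the first
    coordinate, which is free, and raises the second by \<open>b - a\<close>.\<close>
  show "C a b - C b a \<le> b - a"
    using copula_lipschitz[OF C mem(2,1,1,2)] ab by simp
qed

text \<open>For \<open>1/4 \<le> d\<close> the left side is the maximum of \<open>0\<close>,
  \<open>u - (1 - 2 * d)\<close> and \<open>2 * u - 1\<close>. The asymmetry forces the second,
  which beats the other two between \<open>1 - 2 * d\<close> and \<open>2 * d\<close>.\<close>

lemma diagonal_ge:
  assumes C: "copula C" and ab: "0 \<le> a" "a \<le> b" "b \<le> 1" and d: "d = C a b - C b a" "1/4 \<le> d"
    and u: "0 \<le> u" "u \<le> 1"
  shows "max 0 (u - (1 - 2 * d)) + max 0 (u - 2 * d) \<le> C u u"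
proof -
  have mem: "a \<in> {0..1}" "b \<in> {0..1}" "u \<in> {0..1}" using ab u by auto
  have k: "d \<le> a" "d \<le> b - a" "d \<le> 1 - b" using asymmetry_constraints[OF C ab] d by auto
  have "C a b \<le> C u u + max 0 (a - u) + max 0 (b - u)" using copula_lipschitz[OF C] mem by auto
  moreover have "0 \<le> C b a" "b + a - 1 \<le> C b a" "0 \<le> C u u" "u + u - 1 \<le> C u u"
    using copula_frechet[OF C mem(2,1)] copula_frechet[OF C mem(3,3)] by auto
  ultimately show ?thesis using k d ab u by linarith
qed

text \<open>The left side is the tent \<open>max 0 (d - \<bar>u - a\<bar>)\<close> written in
  hinges. Moving from \<open>(u, 1 - u)\<close> to \<open>(a, b)\<close> costs at most
  \<open>\<bar>u - a\<bar> + max 0 (a + b - 1)\<close>, and the last term is regained from the lower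
  bound for \<open>C b a\<close>.\<close>

lemma antidiagonal_ge:
  assumes C: "copula C" and ab: "0 \<le> a" "a \<le> b" "b \<le> 1" and d: "d = C a b - C b a" "0 \<le> d"
    and u: "0 \<le> u" "u \<le> 1"
  shows "max 0 (u - (a - d)) - 2 * max 0 (u - a) + max 0 (u - (a + d)) \<le> C u (1 - u)"
proof -
  have mem: "a \<in> {0..1}" "b \<in> {0..1}" "u \<in> {0..1}" "1 - u \<in> {0..1}" using ab u by auto
  have k: "d \<le> a" "d \<le> b - a" "d \<le> 1 - b" using asymmetry_constraints[OF C ab] d by auto
  have "C a b \<le> C u (1 - u) + max 0 (a - u) + max 0 (b - (1 - u))"
    using copula_lipschitz[OF C mem(3,1,4,2)] .
  moreover have f: "0 \<le> C b a" "b + a - 1 \<le> C b a" "0 \<le> C u (1 - u)"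
    using copula_frechet[OF C mem(2,1)] copula_frechet[OF C mem(3,4)] by auto
  ultimately have "max 0 (d - \<bar>u - a\<bar>) \<le> C u (1 - u)" using k d ab u by linarith
  moreover have "max 0 (u - (a - d)) - 2 * max 0 (u - a) + max 0 (u - (a + d)) = max 0 (d - \<bar>u - a\<bar>)"
    using d(2) by (auto simp: max_def abs_if)
  ultimately show ?thesis by simp
qed

text \<open>The bound is the minimum of \<open>u\<close> and
  \<open>a - d + max 0 (u - a) + max 0 (u - b)\<close>, the latter because
  \<open>C b a \<le> a - d\<close>. Its deficit below \<open>u\<close> is a trapezoid of height
  \<open>d\<close> with feet \<open>a - d\<close> and \<open>b + d\<close>.\<close>

lemma diagonal_le:
  assumes C: "copula C" and ab: "0 \<le> a" "a \<le> b" "b \<le> 1" and d: "d = C a b - C b a" "0 \<le> d"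
    and u: "0 \<le> u" "u \<le> 1"
  shows "C u u \<le> u - max 0 (u - (a - d)) + max 0 (u - a) + max 0 (u - b) - max 0 (u - (b + d))"
proof -
  have mem: "a \<in> {0..1}" "b \<in> {0..1}" "u \<in> {0..1}" using ab u by auto
  have k: "d \<le> a" "d \<le> b - a" "d \<le> 1 - b" using asymmetry_constraints[OF C ab] d by auto
  have "C u u \<le> C b a + max 0 (u - b) + max 0 (u - a)"
    using copula_lipschitz[OF C mem(2,3,1,3)] .
  moreover have "C a b \<le> a" "C u u \<le> u"
    using copula_frechet[OF C mem(1,2)] copula_frechet[OF C mem(3,3)] by auto
  note facts = calculation this k d ab u
  have "u \<le> a - d \<or> a - d \<le> u \<and> u \<le> a \<or> a \<le> u \<and> u \<le> b \<or> b \<le> u \<and> u \<le> b + d \<or> b + d \<le> u" by linarith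
  then show ?thesis
    using facts by (elim disjE conjE) (simp_all add: hinge_eq)
qed

text \<open>The constraints on \<open>d\<close> eliminate \<open>a\<close> and \<open>b\<close> in
  each of the four positions of \<open>u\<close>. As \<open>d \<le> 1/3\<close>, the inner maximum
  equals \<open>max 0 (u - 2 * d) + max 0 (1 - u - d)\<close>, the bound for the worst case
  \<open>(d, 2 * d)\<close>.\<close>

lemma antidiagonal_le:
  assumes C: "copula C" and ab: "0 \<le> a" "a \<le> b" "b \<le> 1" and d: "d = C a b - C b a" "0 \<le> d"
    and u: "0 \<le> u" "u \<le> 1"
  shows "C u (1 - u) \<le> min (min u (1 - u)) (max (max (u - 2 * d) (1 - u - d)) (1 - 3 * d))"
proof -
  have mem: "a \<in> {0..1}" "b \<in> {0..1}" "u \<in> {0..1}" "1 - u \<in> {0..1}" using ab u by auto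
  have k: "d \<le> a" "d \<le> b - a" "d \<le> 1 - b" using asymmetry_constraints[OF C ab] d by auto
  have "C u (1 - u) \<le> C b a + max 0 (u - b) + max 0 (1 - u - a)"
    using copula_lipschitz[OF C mem(2,3,1,4)] .
  moreover have "C a b \<le> a" "C u (1 - u) \<le> u" "C u (1 - u) \<le> 1 - u"
    using copula_frechet[OF C mem(1,2)] copula_frechet[OF C mem(3,4)] by auto
  ultimately show ?thesis using k d ab u
    by (cases "u \<le> b"; cases "1 - u \<le> a"; simp)
qed

text \<open>The tent on the antidiagonal has area \<open>d\<^sup>2\<close>. On the diagonal
  \<open>copula_W\<close> is the bound for every \<open>d\<close>, and \<open>diagonal_ge\<close>
  improves it once \<open>1/4 \<le> d\<close>.\<close>

lemma gini_gamma_ge: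
  assumes C: "copula C" and ab: "0 \<le> a" "a \<le> b" "b \<le> 1" and d: "d = C a b - C b a" "0 \<le> d"
  shows "4 * d\<^sup>2 - 1 \<le> gini_gamma C" "1/4 \<le> d \<Longrightarrow> 20 * d\<^sup>2 - 8 * d \<le> gini_gamma C"
proof -
  have k: "d \<le> a" "d \<le> b - a" "d \<le> 1 - b" using asymmetry_constraints[OF C ab] d by auto
  have "(\<Sum>(k, c)\<leftarrow>[(1, a - d), (- 2, a), (1, a + d)]. k * ((1 - c)\<^sup>2 / 2)) \<le> integral {0..1} (\<lambda>t. C t (1 - t))"
    using antidiagonal_ge[OF C ab d] k d(2) ab
    by (intro integral_ge_hinges antidiagonal_integrable[OF C]) (auto simp: algebra_simps)
  hence anti: "d\<^sup>2 \<le> integral {0..1} (\<lambda>t. C t (1 - t))"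
    by (simp add: power2_eq_square field_simps)
  have "(\<Sum>(k, c)\<leftarrow>[(2, 1/2)]. k * ((1 - c)\<^sup>2 / 2)) \<le> integral {0..1} (\<lambda>t. C t t)"
  proof (rule integral_ge_hinges[OF diagonal_integrable[OF C]])
    fix u :: real assume "0 \<le> u" "u \<le> 1"
    thus "(\<Sum>(k, c)\<leftarrow>[(2, 1/2)]. k * max 0 (u - c)) \<le> C u u"
      using copula_frechet(1,2)[OF C, of u u] by (auto simp: max_def)
  qed auto
  thus "4 * d\<^sup>2 - 1 \<le> gini_gamma C"
    using anti by (simp add: gini_gamma_eq[OF C] power2_eq_square)
  show "20 * d\<^sup>2 - 8 * d \<le> gini_gamma C" if "1/4 \<le> d"
  proof -
    have "(\<Sum>(k, c)\<leftarrow>[(1, 1 - 2 * d), (1, 2 * d)]. k * ((1 - c)\<^sup>2 / 2)) \<le> integral {0..1} (\<lambda>t. C t t)"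
      using diagonal_ge[OF C ab d(1) that] k d ab
      by (intro integral_ge_hinges diagonal_integrable[OF C]) auto
    thus ?thesis using anti by (simp add: gini_gamma_eq[OF C] power2_eq_square field_simps)
  qed
qed

text \<open>The diagonal contributes at most \<open>1/2 - 2 * d\<^sup>2\<close> in all four bounds.
  The case distinction comes from the antidiagonal, where the envelope of
  \<open>antidiagonal_le\<close> changes shape at \<open>1/6\<close>, \<open>1/5\<close> and
  \<open>1/4\<close>; below \<open>1/6\<close> the tent \<open>min u (1 - u)\<close> is not
  cut.\<close>

lemma gini_gamma_le:
  assumes C: "copula C" and ab: "0 \<le> a" "a \<le> b" "b \<le> 1" and d: "d = C a b - C b a" "0 \<le> d"
  shows "gini_gamma C \<le> 1 - 8 * d\<^sup>2"
    and "1/6 \<le> d \<Longrightarrow> d \<le> 1/5 \<Longrightarrow> gini_gamma C \<le> 12 * d - 44 * d\<^sup>2"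
    and "1/5 \<le> d \<Longrightarrow> d \<le> 1/4 \<Longrightarrow> gini_gamma C \<le> 1 + 2 * d - 19 * d\<^sup>2"
    and "1/4 \<le> d \<Longrightarrow> gini_gamma C \<le> 2 - 6 * d - 3 * d\<^sup>2"
proof -
  have k: "d \<le> a" "d \<le> b - a" "d \<le> 1 - b" using asymmetry_constraints[OF C ab] d by auto
  hence d3: "d \<le> 1/3" by linarith
  note E_int = antidiagonal_integrable[OF C]
  note E = antidiagonal_le[OF C ab d]
  have "integral {0..1} (\<lambda>t. C t t) \<le>
      (\<Sum>(k, c)\<leftarrow>[(1, 0), (- 1, a - d), (1, a), (1, b), (- 1, b + d)]. k * ((1 - c)\<^sup>2 / 2))"
    using diagonal_le[OF C ab d] k d(2) ab
    by (intro integral_le_hinges diagonal_integrable[OF C]) (auto simp: algebra_simps)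
  hence "integral {0..1} (\<lambda>t. C t t) \<le> 1/2 - d\<^sup>2 - d * (b - a)"
    by (simp add: power2_eq_square field_simps)
  \<comment> \<open>The trapezoid of area \<open>d\<^sup>2 + d * (b - a)\<close> is smallest when
    \<open>b - a = d\<close>.\<close>
  moreover have "d * d \<le> d * (b - a)" using k d by (intro mult_left_mono) auto
  ultimately have D: "integral {0..1} (\<lambda>t. C t t) \<le> 1/2 - 2 * d\<^sup>2" by (simp add: power2_eq_square)
  have "integral {0..1} (\<lambda>t. C t (1 - t)) \<le> (\<Sum>(k, c)\<leftarrow>[(1, 0), (- 2, 1/2)]. k * ((1 - c)\<^sup>2 / 2))"
  proof (rule integral_le_hinges[OF E_int])
    fix u :: real assume u: "0 \<le> u" "u \<le> 1"
    show "C u (1 - u) \<le> (\<Sum>(k, c)\<leftarrow>[(1, 0), (- 2, 1/2)]. k * max 0 (u - c))"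
      using E[OF u] u by (auto simp: max_def split: if_splits)
  qed auto
  with D show "gini_gamma C \<le> 1 - 8 * d\<^sup>2"
    by (simp add: gini_gamma_eq[OF C] power2_eq_square)
  show "gini_gamma C \<le> 12 * d - 44 * d\<^sup>2" if "1/6 \<le> d" "d \<le> 1/5"
  proof -
    \<comment> \<open>The tent is cut at height \<open>1 - 3 * d\<close>, between the points
      \<open>1 - 3 * d\<close> and \<open>3 * d\<close>.\<close>
    have "integral {0..1} (\<lambda>t. C t (1 - t)) \<le>
        (\<Sum>(k, c)\<leftarrow>[(1, 0), (- 1, 1 - 3 * d), (- 1, 3 * d)]. k * ((1 - c)\<^sup>2 / 2))"
    proof (rule integral_le_hinges[OF E_int])
      fix u :: real assume u: "0 \<le> u" "u \<le> 1"
      have "C u (1 - u) \<le> u - max 0 (u - (1 - 3 * d)) - max 0 (u - 3 * d)"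
        using E[OF u] u that by linarith
      thus "C u (1 - u) \<le> (\<Sum>(k, c)\<leftarrow>[(1, 0), (- 1, 1 - 3 * d), (- 1, 3 * d)]. k * max 0 (u - c))"
        using u by simp
    qed (use that in auto)
    with D show ?thesis by (simp add: gini_gamma_eq[OF C] power2_eq_square field_simps)
  qed
  show "gini_gamma C \<le> 1 + 2 * d - 19 * d\<^sup>2" if "1/5 \<le> d" "d \<le> 1/4"
  proof -
    \<comment> \<open>The line \<open>1 - u - d\<close> meets \<open>u\<close> at
      \<open>1/2 - d/2\<close> and the plateau \<open>1 - 3 * d\<close> at \<open>2 * d\<close>;
      these points are in this order exactly when \<open>1/5 \<le> d\<close>.\<close>
    have "integral {0..1} (\<lambda>t. C t (1 - t)) \<le>
        (\<Sum>(k, c)\<leftarrow>[(1, 0), (- 2, 1 / 2 - d / 2), (1, 2 * d), (- 1, 3 * d)]. k * ((1 - c)\<^sup>2 / 2))"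
    proof (rule integral_le_hinges[OF E_int])
      fix u :: real assume u: "0 \<le> u" "u \<le> 1"
      consider "u \<le> 1 / 2 - d / 2" | "1 / 2 - d / 2 \<le> u" "u \<le> 2 * d" | "2 * d \<le> u" "u \<le> 3 * d" | "3 * d \<le> u"
        by linarith
      hence "C u (1 - u) \<le> u - 2 * max 0 (u - (1 / 2 - d / 2)) + max 0 (u - 2 * d) - max 0 (u - 3 * d)"
      proof cases
        case 1
        thus ?thesis using E[OF u] that by (simp add: hinge_eq)
      next
        case 2
        hence "max (max (u - 2 * d) (1 - u - d)) (1 - 3 * d) = 1 - u - d" using that by (simp add: max_def)
        thus ?thesis using E[OF u] that 2 by (simp add: hinge_eq)
      next
        case 3
        hence "max (max (u - 2 * d) (1 - u - d)) (1 - 3 * d) = 1 - 3 * d" using that by (simp add: max_def)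
        thus ?thesis using E[OF u] that 3 by (simp add: hinge_eq)
      next
        case 4
        thus ?thesis using E[OF u] that by (simp add: hinge_eq)
      qed
      thus "C u (1 - u) \<le> (\<Sum>(k, c)\<leftarrow>[(1, 0), (- 2, 1 / 2 - d / 2), (1, 2 * d), (- 1, 3 * d)]. k * max 0 (u - c))"
        using u by simp
    qed (use that in auto)
    with D show ?thesis by (simp add: gini_gamma_eq[OF C] power2_eq_square field_simps)
  qed
  show "gini_gamma C \<le> 2 - 6 * d - 3 * d\<^sup>2" if "1/4 \<le> d"
  proof -
    \<comment> \<open>Now \<open>1 - d \<le> 3 * d\<close>, so the line \<open>u - 2 * d\<close>
      leaves the plateau at \<open>1 - d\<close>, before \<open>1 - u\<close> would end it, and
      meets \<open>1 - u\<close> at \<open>1/2 + d\<close>.\<close>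
    have "integral {0..1} (\<lambda>t. C t (1 - t)) \<le> (\<Sum>(k, c)\<leftarrow>[(1, 0), (- 2, 1 / 2 - d / 2), (1, 2 * d),
        (1, 1 - d), (- 2, 1 / 2 + d)]. k * ((1 - c)\<^sup>2 / 2))"
    proof (rule integral_le_hinges[OF E_int])
      fix u :: real assume u: "0 \<le> u" "u \<le> 1"
      consider "u \<le> 1 / 2 - d / 2" | "1 / 2 - d / 2 \<le> u" "u \<le> 2 * d" | "2 * d \<le> u" "u \<le> 1 - d"
        | "1 - d \<le> u" "u \<le> 1 / 2 + d" | "1 / 2 + d \<le> u"
        by linarith
      hence "C u (1 - u) \<le> u - 2 * max 0 (u - (1 / 2 - d / 2)) + max 0 (u - 2 * d) + max 0 (u - (1 - d))
          - 2 * max 0 (u - (1 / 2 + d))"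
      proof cases
        case 1
        thus ?thesis using E[OF u] that d3 by (simp add: hinge_eq)
      next
        case 2
        hence "max (max (u - 2 * d) (1 - u - d)) (1 - 3 * d) = 1 - u - d" using that d3 by (simp add: max_def)
        thus ?thesis using E[OF u] that d3 2 by (simp add: hinge_eq)
      next
        case 3
        hence "max (max (u - 2 * d) (1 - u - d)) (1 - 3 * d) = 1 - 3 * d" using that d3 by (simp add: max_def)
        thus ?thesis using E[OF u] that d3 3 by (simp add: hinge_eq)
      next
        case 4
        hence "max (max (u - 2 * d) (1 - u - d)) (1 - 3 * d) = u - 2 * d" using that d3 by (simp add: max_def)
        thus ?thesis using E[OF u] that d3 4 by (simp add: hinge_eq)
      next
        case 5
        thus ?thesis using E[OF u] that d3 by (simp add: hinge_eq)
      qed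
      thus "C u (1 - u) \<le> (\<Sum>(k, c)\<leftarrow>[(1, 0), (- 2, 1 / 2 - d / 2), (1, 2 * d), (1, 1 - d),
          (- 2, 1 / 2 + d)]. k * max 0 (u - c))"
        using u by simp
    qed (use that d3 in auto)
    with D show ?thesis by (simp add: gini_gamma_eq[OF C] power2_eq_square field_simps)
  qed
qed

subsection \<open>Values at the extremal copulas\<close>

text \<open>By the Lipschitz property this is the pointwise largest copula that vanishes at
  \<open>(2 * d, d)\<close>, so it meets the upper bounds for the point
  \<open>(d, 2 * d)\<close>.\<close>

lemma upper_copula_eq:
  assumes "0 \<le> d" "d \<le> 1/3" "0 \<le> u" "0 \<le> v"
  shows "upper_copula d u v = min (min u v) (max 0 (u - 2 * d) + max 0 (v - d))"
proof -
  have "u \<le> 2 * d \<or> 2 * d \<le> u \<and> u \<le> 3 * d \<or> 3 * d \<le> u"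
    "v \<le> d \<or> d \<le> v \<and> v \<le> 3 * d \<or> 3 * d \<le> v" by linarith+
  thus ?thesis
    using assms by (elim disjE conjE;
      simp add: upper_copula_def min.absorb1 min.absorb2 max.absorb1 max.absorb2; simp add: min_def)
qed

text \<open>Dually, this is the pointwise smallest copula with value \<open>d\<close> at
  \<open>(d, 1 - d)\<close>.\<close>

lemma lower_copula_eq:
  assumes "0 \<le> d" "d \<le> 1/3" "0 \<le> u" "u \<le> 1" "0 \<le> v" "v \<le> 1"
  shows "lower_copula d u v = max (max 0 (u + v - 1)) (d - max 0 (d - u) - max 0 (1 - d - v))"
proof -
  have "u \<le> d \<or> d \<le> u \<and> u \<le> 2 * d \<or> 2 * d \<le> u"
    "v \<le> 1 - 2 * d \<or> 1 - 2 * d \<le> v \<and> v \<le> 1 - d \<or> 1 - d \<le> v" by linarith+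
  thus ?thesis
    using assms by (elim disjE conjE;
      simp add: lower_copula_def min.absorb1 min.absorb2 max.absorb1 max.absorb2; simp add: max_def)
qed

text \<open>The hinge lists are those of \<open>antidiagonal_ge\<close> and
  \<open>diagonal_ge\<close> at \<open>(d, 1 - d)\<close>, so \<open>gini_gamma_ge\<close> is
  sharp.\<close>

lemma gini_gamma_lower_copula:
  assumes "0 \<le> d" "d \<le> 1/3"
  shows "gini_gamma (lower_copula d) = (if d \<le> 1/4 then 4 * d\<^sup>2 - 1 else 20 * d\<^sup>2 - 8 * d)"
proof -
  have anti: "integral {0..1} (\<lambda>t. lower_copula d t (1 - t)) =
      (\<Sum>(k, c)\<leftarrow>[(1, 0), (- 2, d), (1, 2 * d)]. k * ((1 - c)\<^sup>2 / 2))"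
  proof (rule integral_eq_hinges)
    fix u :: real assume u: "0 \<le> u" "u \<le> 1"
    have "u \<le> d \<or> d \<le> u \<and> u \<le> 2 * d \<or> 2 * d \<le> u" by linarith
    thus "lower_copula d u (1 - u) = (\<Sum>(k, c)\<leftarrow>[(1, 0), (- 2, d), (1, 2 * d)]. k * max 0 (u - c))"
      using assms u by (elim disjE conjE; simp add: lower_copula_eq hinge_eq; simp add: max_def)
  qed (use assms in auto)
  show ?thesis
  proof (cases "d \<le> 1/4")
    case True
    have "integral {0..1} (\<lambda>t. lower_copula d t t) = (\<Sum>(k, c)\<leftarrow>[(2, 1/2)]. k * ((1 - c)\<^sup>2 / 2))"
    proof (rule integral_eq_hinges)
      fix u :: real assume u: "0 \<le> u" "u \<le> 1"
      show "lower_copula d u u = (\<Sum>(k, c)\<leftarrow>[(2, 1/2)]. k * max 0 (u - c))"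
        using True assms u by (simp add: lower_copula_eq max_def)
    qed auto
    thus ?thesis using True assms anti
      by (simp add: gini_gamma_eq copula_lower_copula power2_eq_square field_simps)
  next
    case False
    have "integral {0..1} (\<lambda>t. lower_copula d t t) =
        (\<Sum>(k, c)\<leftarrow>[(1, 1 - 2 * d), (1, 2 * d)]. k * ((1 - c)\<^sup>2 / 2))"
    proof (rule integral_eq_hinges)
      fix u :: real assume u: "0 \<le> u" "u \<le> 1"
      show "lower_copula d u u = (\<Sum>(k, c)\<leftarrow>[(1, 1 - 2 * d), (1, 2 * d)]. k * max 0 (u - c))"
        using False assms u by (simp add: lower_copula_eq max_def)
    qed (use assms False in auto)
    thus ?thesis using False assms anti
      by (simp add: gini_gamma_eq copula_lower_copula power2_eq_square field_simps)
  qed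
qed

text \<open>Both diagonals coincide with the envelopes behind \<open>gini_gamma_le\<close> at
  \<open>(d, 2 * d)\<close>; neighbouring quadratics agree at the thresholds.\<close>

lemma gini_gamma_upper_copula:
  assumes "0 \<le> d" "d \<le> 1/3"
  shows "gini_gamma (upper_copula d) =
    (if d < 1/6 then 1 - 8 * d\<^sup>2 else if d < 1/5 then 12 * d - 44 * d\<^sup>2
     else if d < 1/4 then 1 + 2 * d - 19 * d\<^sup>2 else 2 - 6 * d - 3 * d\<^sup>2)"
proof -
  have "integral {0..1} (\<lambda>t. upper_copula d t t) =
      (\<Sum>(k, c)\<leftarrow>[(1, d), (1, 2 * d), (- 1, 3 * d)]. k * ((1 - c)\<^sup>2 / 2))"
  proof (rule integral_eq_hinges)
    fix u :: real assume u: "0 \<le> u" "u \<le> 1"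
    have "u \<le> d \<or> d \<le> u \<and> u \<le> 2 * d \<or> 2 * d \<le> u \<and> u \<le> 3 * d \<or> 3 * d \<le> u" by linarith
    thus "upper_copula d u u = (\<Sum>(k, c)\<leftarrow>[(1, d), (1, 2 * d), (- 1, 3 * d)]. k * max 0 (u - c))"
      using assms u by (elim disjE conjE; simp add: upper_copula_eq hinge_eq; simp add: min_def)
  qed (use assms in auto)
  hence diag: "integral {0..1} (\<lambda>t. upper_copula d t t) = 1/2 - 2 * d\<^sup>2"
    by (simp add: power2_eq_square field_simps)
  have E: "upper_copula d u (1 - u) = min (min u (1 - u)) (max 0 (u - 2 * d) + max 0 (1 - u - d))"
    if "0 \<le> u" "u \<le> 1" for u
    using upper_copula_eq[of d u "1 - u"] that assms by simp
  note G = gini_gamma_eq[OF copula_upper_copula[OF assms]] diag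
  consider "d < 1/6" | "1/6 \<le> d" "d < 1/5" | "1/5 \<le> d" "d < 1/4" | "1/4 \<le> d" by linarith
  thus ?thesis
  proof cases
    case 1
    have "integral {0..1} (\<lambda>t. upper_copula d t (1 - t)) = (\<Sum>(k, c)\<leftarrow>[(1, 0), (- 2, 1/2)]. k * ((1 - c)\<^sup>2 / 2))"
    proof (rule integral_eq_hinges)
      fix u :: real assume u: "0 \<le> u" "u \<le> 1"
      have "u \<le> 1/2 \<or> 1/2 \<le> u" by linarith
      thus "upper_copula d u (1 - u) = (\<Sum>(k, c)\<leftarrow>[(1, 0), (- 2, 1/2)]. k * max 0 (u - c))"
        using 1 assms u by (elim disjE; simp add: E; simp add: min_def max_def)
    qed auto
    thus ?thesis using 1 by (simp add: G power2_eq_square field_simps)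
  next
    case 2
    have "integral {0..1} (\<lambda>t. upper_copula d t (1 - t)) =
        (\<Sum>(k, c)\<leftarrow>[(1, 0), (- 1, 1 - 3 * d), (- 1, 3 * d)]. k * ((1 - c)\<^sup>2 / 2))"
    proof (rule integral_eq_hinges)
      fix u :: real assume u: "0 \<le> u" "u \<le> 1"
      have "u \<le> 1 - 3 * d \<or> 1 - 3 * d \<le> u \<and> u \<le> 3 * d \<or> 3 * d \<le> u" by linarith
      thus "upper_copula d u (1 - u) = (\<Sum>(k, c)\<leftarrow>[(1, 0), (- 1, 1 - 3 * d), (- 1, 3 * d)]. k * max 0 (u - c))"
        using 2 assms u by (elim disjE conjE; simp add: E hinge_eq; simp add: min_def max_def)
    qed (use 2 in auto)
    thus ?thesis using 2 by (simp add: G power2_eq_square field_simps)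
  next
    case 3
    have "integral {0..1} (\<lambda>t. upper_copula d t (1 - t)) =
        (\<Sum>(k, c)\<leftarrow>[(1, 0), (- 2, 1 / 2 - d / 2), (1, 2 * d), (- 1, 3 * d)]. k * ((1 - c)\<^sup>2 / 2))"
    proof (rule integral_eq_hinges)
      fix u :: real assume u: "0 \<le> u" "u \<le> 1"
      have "u \<le> 1 / 2 - d / 2 \<or> 1 / 2 - d / 2 \<le> u \<and> u \<le> 2 * d \<or> 2 * d \<le> u \<and> u \<le> 3 * d \<or> 3 * d \<le> u"
        by linarith
      thus "upper_copula d u (1 - u) =
          (\<Sum>(k, c)\<leftarrow>[(1, 0), (- 2, 1 / 2 - d / 2), (1, 2 * d), (- 1, 3 * d)]. k * max 0 (u - c))"
        using 3 assms u by (elim disjE conjE; simp add: E hinge_eq; simp add: min_def max_def)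
    qed (use 3 in auto)
    thus ?thesis using 3 by (simp add: G power2_eq_square field_simps)
  next
    case 4
    have "integral {0..1} (\<lambda>t. upper_copula d t (1 - t)) =
        (\<Sum>(k, c)\<leftarrow>[(1, 0), (- 2, 1 / 2 - d / 2), (1, 2 * d), (1, 1 - d), (- 2, 1 / 2 + d)]. k * ((1 - c)\<^sup>2 / 2))"
    proof (rule integral_eq_hinges)
      fix u :: real assume u: "0 \<le> u" "u \<le> 1"
      have "u \<le> 1 / 2 - d / 2 \<or> 1 / 2 - d / 2 \<le> u \<and> u \<le> 2 * d \<or> 2 * d \<le> u \<and> u \<le> 1 - d
          \<or> 1 - d \<le> u \<and> u \<le> 1 / 2 + d \<or> 1 / 2 + d \<le> u"
        by linarith
      thus "upper_copula d u (1 - u) = (\<Sum>(k, c)\<leftarrow>[(1, 0), (- 2, 1 / 2 - d / 2), (1, 2 * d), (1, 1 - d),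
          (- 2, 1 / 2 + d)]. k * max 0 (u - c))"
        using 4 assms u by (elim disjE conjE; simp add: E hinge_eq; simp add: min_def max_def)
    qed (use 4 assms in auto)
    thus ?thesis using 4 by (simp add: G power2_eq_square field_simps)
  qed
qed

lemma gini_gamma_M: "gini_gamma copula_M = 1"
proof -
  have "integral {0..1} (\<lambda>t. copula_M t t) = (\<Sum>(k, c)\<leftarrow>[(1, 0)]. k * ((1 - c)\<^sup>2 / 2))"
    by (rule integral_eq_hinges) (auto simp: copula_M_def)
  moreover have "integral {0..1} (\<lambda>t. copula_M t (1 - t)) = (\<Sum>(k, c)\<leftarrow>[(1, 0), (- 2, 1/2)]. k * ((1 - c)\<^sup>2 / 2))"
    by (rule integral_eq_hinges) (auto simp: copula_M_def min_def max_def)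
  ultimately show ?thesis by (simp add: gini_gamma_eq[OF copula_M] power2_eq_square)
qed

lemma gini_gamma_W: "gini_gamma copula_W = - 1"
proof -
  have "integral {0..1} (\<lambda>t. copula_W t t) = (\<Sum>(k, c)\<leftarrow>[(2, 1/2)]. k * ((1 - c)\<^sup>2 / 2))"
    by (rule integral_eq_hinges) (auto simp: copula_W_def max_def)
  moreover have "integral {0..1} (\<lambda>t. copula_W t (1 - t)) = 0"
    by (simp add: copula_W_def)
  ultimately show ?thesis by (simp add: gini_gamma_eq[OF copula_W] power2_eq_square)
qed

lemma gini_gamma_convex:
  assumes A: "copula A" and B: "copula B" and s: "0 \<le> s" "s \<le> 1"
  shows "gini_gamma (\<lambda>u v. (1 - s) * A u v + s * B u v) = (1 - s) * gini_gamma A + s * gini_gamma B"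
proof -
  note integrable = integrable_on_mult_right diagonal_integrable[OF A] diagonal_integrable[OF B]
    antidiagonal_integrable[OF A] antidiagonal_integrable[OF B]
  have "integral {0..1} (\<lambda>t. (1 - s) * A t t + s * B t t) =
      (1 - s) * integral {0..1} (\<lambda>t. A t t) + s * integral {0..1} (\<lambda>t. B t t)"
    by (simp add: integral_add integrable)
  moreover have "integral {0..1} (\<lambda>t. (1 - s) * A t (1 - t) + s * B t (1 - t)) =
      (1 - s) * integral {0..1} (\<lambda>t. A t (1 - t)) + s * integral {0..1} (\<lambda>t. B t (1 - t))"
    by (simp add: integral_add integrable)
  ultimately show ?thesis
    unfolding gini_gamma_eq[OF A] gini_gamma_eq[OF B] gini_gamma_eq[OF copula_convex[OF A B s]]
    by (simp only:) (simp add: algebra_simps)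
qed

subsection \<open>Attainment\<close>

text \<open>Each branch is one quadratic inequality solved for \<open>d\<close> by completing the
  square. If \<open>d\<close> lies below the range of that quadratic, the value of the root at an
  end of the branch already dominates.\<close>

lemma le_asymmetry_bound:
  assumes "0 \<le> d" "d \<le> 1/3" "4 * d\<^sup>2 - 1 \<le> g" "1/4 \<le> d \<Longrightarrow> 20 * d\<^sup>2 - 8 * d \<le> g"
    and "g \<le> 1 - 8 * d\<^sup>2" "1/6 \<le> d \<Longrightarrow> d \<le> 1/5 \<Longrightarrow> g \<le> 12 * d - 44 * d\<^sup>2"
    and "1/5 \<le> d \<Longrightarrow> d \<le> 1/4 \<Longrightarrow> g \<le> 1 + 2 * d - 19 * d\<^sup>2"
    and "1/4 \<le> d \<Longrightarrow> g \<le> 2 - 6 * d - 3 * d\<^sup>2"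
  shows "d \<le> asymmetry_bound g"
proof -
  have sq: "x * x \<le> d\<^sup>2" if "0 \<le> x" "x \<le> d" for x
    using mult_mono[OF that(2) that(2)] that assms(1) by (simp add: power2_eq_square)
  consider "g \<le> - 3/4" | "- 3/4 < g" "g \<le> - 4/9" | "- 4/9 < g" "g \<le> - 1/3" | "- 1/3 < g" "g \<le> 5/16"
    | "5/16 < g" "g \<le> 16/25" | "16/25 < g" "g \<le> 7/9" | "7/9 < g" by linarith
  thus ?thesis
  proof cases
    case 1
    have "2 * d \<le> sqrt (g + 1)" using assms(3) by (intro real_le_rsqrt) (simp add: power2_eq_square)
    thus ?thesis using 1 by (simp add: asymmetry_bound_def)
  next
    case 2
    have "10 * d - 2 \<le> sqrt (5 * g + 4)"
    proof (cases "1/4 \<le> d")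
      case True
      thus ?thesis using assms(4) by (intro real_le_rsqrt) (simp add: power2_eq_square algebra_simps)
    next
      case False
      have "1/2 \<le> sqrt (5 * g + 4)" using 2 by (intro real_le_rsqrt) (simp add: power2_eq_square)
      thus ?thesis using False by simp
    qed
    thus ?thesis using 2 by (simp add: asymmetry_bound_def)
  next
    case 3
    thus ?thesis using assms(2) by (simp add: asymmetry_bound_def)
  next
    case 4
    have "3 * d + 3 \<le> sqrt (15 - 3 * g)"
    proof (cases "1/4 \<le> d")
      case True
      thus ?thesis using assms(8) by (intro real_le_rsqrt) (simp add: power2_eq_square algebra_simps)
    next
      case False
      have "15/4 \<le> sqrt (15 - 3 * g)" using 4 by (intro real_le_rsqrt) (simp add: power2_eq_square)
      thus ?thesis using False by simp
    qed
    thus ?thesis using 4 by (simp add: asymmetry_bound_def)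
  next
    case 5
    \<comment> \<open>The quadratic \<open>2 - 6 * d - 3 * d\<^sup>2\<close> decreases through
      \<open>5/16\<close> at \<open>d = 1/4\<close>.\<close>
    have d4: "d \<le> 1/4"
    proof (rule ccontr)
      assume "\<not> d \<le> 1/4"
      thus False using assms(8) sq[of "1/4"] 5 by simp
    qed
    have "19 * d - 1 \<le> sqrt (20 - 19 * g)"
    proof (cases "1/5 \<le> d")
      case True
      thus ?thesis using assms(7) d4 by (intro real_le_rsqrt) (simp add: power2_eq_square algebra_simps)
    next
      case False
      have "14/5 \<le> sqrt (20 - 19 * g)" using 5 by (intro real_le_rsqrt) (simp add: power2_eq_square)
      thus ?thesis using False by simp
    qed
    thus ?thesis using 5 by (simp add: asymmetry_bound_def)
  next
    case 6
    have d5: "d \<le> 1/5"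
    proof (rule ccontr)
      assume d: "\<not> d \<le> 1/5"
      \<comment> \<open>The product is \<open>16/25 - (1 + 2 * d - 19 * d\<^sup>2)\<close>, factored
        at its root \<open>1/5\<close>.\<close>
      have "(d - 1/5) * (19 * d + 9/5) \<ge> 0" using d by (intro mult_nonneg_nonneg) auto
      hence "1 + 2 * d - 19 * d\<^sup>2 \<le> 16/25" by (simp add: power2_eq_square field_simps)
      thus False using assms(7,8) sq[of "1/4"] d 6 by (cases "d \<le> 1/4") auto
    qed
    have "22 * d - 3 \<le> sqrt (9 - 11 * g)"
    proof (cases "1/6 \<le> d")
      case True
      thus ?thesis using assms(6) d5 by (intro real_le_rsqrt) (simp add: power2_eq_square algebra_simps)
    next
      case False
      have "2/3 \<le> sqrt (9 - 11 * g)" using 6 by (intro real_le_rsqrt) (simp add: power2_eq_square)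
      thus ?thesis using False by simp
    qed
    thus ?thesis using 6 by (simp add: asymmetry_bound_def)
  next
    case 7
    have "4 * d \<le> sqrt (2 - 2 * g)" using assms(5) by (intro real_le_rsqrt) (simp add: power2_eq_square)
    thus ?thesis using 7 by (simp add: asymmetry_bound_def)
  qed
qed

section \<open>The supremum and the general bound\<close>

lemma asymmetry_ge:
  assumes C: "copula C" and ab: "0 \<le> a" "a \<le> 1" "0 \<le> b" "b \<le> 1"
  shows "\<bar>C a b - C b a\<bar> \<le> asymmetry C"
proof -
  have "\<bar>C u v - C v u\<bar> \<le> 1" if "u \<in> {0..1}" "v \<in> {0..1}" for u v
    using copula_frechet[OF C that] copula_frechet[OF C that(2,1)] that by auto
  hence "bdd_above ((\<lambda>(u, v). \<bar>C u v - C v u\<bar>) ` ({0..1} \<times> {0..1}))"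
    by (intro bdd_aboveI[where M = 1]) auto
  from cSUP_upper[OF _ this, of "(a, b)"] show ?thesis
    using ab by (simp add: asymmetry_def)
qed

lemma asymmetry_le:
  assumes "\<And>a b. 0 \<le> a \<Longrightarrow> a \<le> 1 \<Longrightarrow> 0 \<le> b \<Longrightarrow> b \<le> 1 \<Longrightarrow> \<bar>C a b - C b a\<bar> \<le> x"
  shows "asymmetry C \<le> x"
  unfolding asymmetry_def by (rule cSUP_least) (use assms in auto)

text \<open>Transposition fixes the diagonal and reverses the antidiagonal, which the substitution
  of \<open>1 - t\<close> for \<open>t\<close> undoes.\<close>

lemma gini_gamma_transpose:
  assumes "copula C"
  shows "gini_gamma (\<lambda>u v. C v u) = gini_gamma C"
proof -
  have "((\<lambda>t. C (- 1 * t + 1) (1 - (- 1 * t + 1))) has_integral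
      (1 / \<bar>- 1\<bar> ^ DIM(real)) *\<^sub>R integral {0..1} (\<lambda>t. C t (1 - t)))
      ((\<lambda>t. (1 / - 1) *\<^sub>R t + - ((1 / - 1) *\<^sub>R 1)) ` cbox 0 1)"
    using has_integral_affinity[OF integrable_integral[OF antidiagonal_integrable[OF assms], folded cbox_interval],
        of "- 1" 1] by simp
  moreover have "(\<lambda>t. (1 / - 1) *\<^sub>R t + - ((1 / - 1) *\<^sub>R 1)) ` cbox 0 1 = {0..1 :: real}"
    by (auto intro!: image_eqI[of _ _ "1 - _"])
  ultimately have "integral {0..1} (\<lambda>t. C (1 - t) t) = integral {0..1} (\<lambda>t. C t (1 - t))"
    by (simp add: integral_unique)
  thus ?thesis by (simp add: gini_gamma_eq copula_transpose assms)
qed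

lemma abs_diff_le_asymmetry_bound:
  assumes C: "copula C" and ab: "0 \<le> a" "a \<le> 1" "0 \<le> b" "b \<le> 1"
  shows "\<bar>C a b - C b a\<bar> \<le> asymmetry_bound (gini_gamma C)"
proof -
  have bound: "D a b - D b a \<le> asymmetry_bound (gini_gamma D)"
    if D: "copula D" and ab: "0 \<le> a" "a \<le> b" "b \<le> 1" and d: "0 \<le> D a b - D b a" for D a b
    using asymmetry_constraints[OF D ab] gini_gamma_ge[OF D ab refl d] gini_gamma_le[OF D ab refl d]
    by (intro le_asymmetry_bound[OF d]) (linarith, assumption+)
  have ordered: "\<bar>C a b - C b a\<bar> \<le> asymmetry_bound (gini_gamma C)"
    if ab: "0 \<le> a" "a \<le> b" "b \<le> 1" for a b
  proof (cases "C b a \<le> C a b")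
    case True
    thus ?thesis using bound[OF C ab] by simp
  next
    \<comment> \<open>A negative difference becomes positive for the transposed copula, whose
      \<gamma> is the same.\<close>
    case False
    thus ?thesis using bound[OF copula_transpose[OF C] ab] gini_gamma_transpose[OF C] by simp
  qed
  show ?thesis
    using ordered[of a b] ordered[of b a] ab by (cases "a \<le> b") (auto simp: abs_minus_commute)
qed

text \<open>The bound holds at every point, so one point that reaches it determines the
  supremum.\<close>

lemma asymmetry_eq_bound:
  assumes C: "copula C" and ab: "0 \<le> a" "a \<le> 1" "0 \<le> b" "b \<le> 1"
    and "C a b - C b a = asymmetry_bound (gini_gamma C)"
  shows "asymmetry C = asymmetry_bound (gini_gamma C)"
proof (rule antisym)
  show "asymmetry C \<le> asymmetry_bound (gini_gamma C)"
    by (rule asymmetry_le) (rule abs_diff_le_asymmetry_bound[OF C])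
  show "asymmetry_bound (gini_gamma C) \<le> asymmetry C"
    using asymmetry_ge[OF C ab] assms(6) by simp
qed

section \<open>Copulas attaining the bounds\<close>

lemma lower_copula_asymmetric:
  assumes "0 \<le> d" "d \<le> 1/3"
  shows "lower_copula d d (1 - d) - lower_copula d (1 - d) d = d"
  using assms by (simp add: lower_copula_eq max_def)

lemma upper_copula_asymmetric:
  assumes "0 \<le> d" "d \<le> 1/3"
  shows "upper_copula d d (2 * d) - upper_copula d (2 * d) d = d"
  using assms by (simp add: upper_copula_eq min_def max_def)

lemma lower_copula_attains:
  assumes d: "d = asymmetry_bound g" "0 \<le> d" "d \<le> 1/3" and g: "gini_gamma (lower_copula d) = g"
  shows "\<exists>C. copula C \<and> gini_gamma C = g \<and> asymmetry C = asymmetry_bound g"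
  using asymmetry_eq_bound[OF copula_lower_copula[OF d(2,3)], of d "1 - d"] lower_copula_asymmetric[OF d(2,3)]
    copula_lower_copula[OF d(2,3)] d g by auto

lemma upper_copula_attains:
  assumes d: "d = asymmetry_bound g" "0 \<le> d" "d \<le> 1/3" and g: "gini_gamma (upper_copula d) = g"
  shows "\<exists>C. copula C \<and> gini_gamma C = g \<and> asymmetry C = asymmetry_bound g"
  using asymmetry_eq_bound[OF copula_upper_copula[OF d(2,3)], of d "2 * d"] upper_copula_asymmetric[OF d(2,3)]
    copula_upper_copula[OF d(2,3)] d g by auto

text \<open>Naming the root \<open>s\<close> makes \<open>d\<close> affine and \<open>g\<close>
  quadratic in \<open>s\<close>, so \<open>gini_gamma\<close> of the shuffle equals \<open>g\<close>
  by algebra. The bounds on \<open>s\<close> place \<open>d\<close> in the matching case of the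
  formula for the shuffle.\<close>

lemma asymmetry_bound_attained:
  assumes g: "- 1 \<le> g" "g \<le> 1"
  shows "\<exists>C. copula C \<and> gini_gamma C = g \<and> asymmetry C = asymmetry_bound g"
proof -
  consider "g \<le> - 3/4" | "- 3/4 < g" "g \<le> - 4/9" | "- 4/9 < g" "g \<le> - 1/3" | "- 1/3 < g" "g \<le> 5/16"
    | "5/16 < g" "g \<le> 16/25" | "16/25 < g" "g \<le> 7/9" | "7/9 < g" by linarith
  thus ?thesis
  proof cases
    case 1
    define s where "s = sqrt (g + 1)"
    have "0 \<le> s" using 1 g by (simp add: s_def)
    moreover have "s \<le> 1/2" unfolding s_def by (rule real_le_lsqrt) (use 1 g in \<open>simp_all add: power2_eq_square\<close>)
    moreover have "s * s = g + 1" using 1 g by (simp add: s_def)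
    ultimately have s: "0 \<le> s" "s \<le> 1/2" "g = s * s - 1" by simp_all
    show ?thesis
      by (rule lower_copula_attains[of "s / 2"])
        (use 1 s in \<open>simp_all add: asymmetry_bound_def s_def[symmetric] gini_gamma_lower_copula power2_eq_square\<close>)
  next
    case 2
    define s where "s = sqrt (5 * g + 4)"
    \<comment> \<open>Strictness gives \<open>d > 1/4\<close>, hence the second case of
      \<open>gini_gamma_lower_copula\<close>.\<close>
    have "1/2 < s" unfolding s_def by (rule real_less_rsqrt) (use 2 g in \<open>simp_all add: power2_eq_square\<close>)
    moreover have "s \<le> 4/3" unfolding s_def by (rule real_le_lsqrt) (use 2 g in \<open>simp_all add: power2_eq_square\<close>)
    moreover have "s * s = 5 * g + 4" using 2 g by (simp add: s_def)
    ultimately have s: "1/2 < s" "s \<le> 4/3" "g = (s * s - 4) / 5" by simp_all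
    show ?thesis
      by (rule lower_copula_attains[of "(s + 2) / 10"])
        (use 2 s in \<open>simp_all add: asymmetry_bound_def s_def[symmetric] gini_gamma_lower_copula power2_eq_square field_simps\<close>)
  next
    case 3
    \<comment> \<open>At \<open>d = 1/3\<close> the shuffles have \<gamma> equal to
      \<open>- 4/9\<close> and \<open>- 1/3\<close>; this weight makes the mixture have \<gamma>
      equal to \<open>g\<close>.\<close>
    define s where "s = 9 * g + 4"
    have s: "0 \<le> s" "s \<le> 1" using 3 by (auto simp: s_def)
    let ?L = "lower_copula (1/3)" and ?U = "upper_copula (1/3)"
    have LU: "copula ?L" "copula ?U" by (auto intro: copula_lower_copula copula_upper_copula)
    let ?C = "\<lambda>u v. (1 - s) * ?L u v + s * ?U u v"
    have C: "copula ?C" using LU s by (rule copula_convex)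
    have \<gamma>: "gini_gamma ?C = g"
      using gini_gamma_convex[OF LU s] gini_gamma_lower_copula[of "1/3"] gini_gamma_upper_copula[of "1/3"]
      by (simp add: s_def power2_eq_square field_simps)
    have "?L (1/3) (2/3) - ?L (2/3) (1/3) = 1/3" "?U (1/3) (2/3) - ?U (2/3) (1/3) = 1/3"
      using lower_copula_asymmetric[of "1/3"] upper_copula_asymmetric[of "1/3"] by simp_all
    hence "?C (1/3) (2/3) - ?C (2/3) (1/3) = 1/3"
      by (simp add: algebra_simps)
    moreover have "asymmetry_bound g = 1/3" using 3 by (simp add: asymmetry_bound_def)
    ultimately have "asymmetry ?C = asymmetry_bound (gini_gamma ?C)"
      by (intro asymmetry_eq_bound[OF C, of "1/3" "2/3"]) (simp_all add: \<gamma>)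
    thus ?thesis using C \<gamma> by auto
  next
    case 4
    define s where "s = sqrt (15 - 3 * g)"
    have "15/4 \<le> s" unfolding s_def by (rule real_le_rsqrt) (use 4 g in \<open>simp_all add: power2_eq_square\<close>)
    moreover have "s < 4" unfolding s_def by (rule real_less_lsqrt) (use 4 g in \<open>simp_all add: power2_eq_square\<close>)
    moreover have "s * s = 15 - 3 * g" using 4 g by (simp add: s_def)
    ultimately have s: "15/4 \<le> s" "s < 4" "g = (15 - s * s) / 3" by simp_all
    have bound: "(s - 3) / 3 = asymmetry_bound g" using 4 by (simp add: asymmetry_bound_def s_def)
    show ?thesis
      by (rule upper_copula_attains[OF bound])
        (use 4 s in \<open>simp_all add: gini_gamma_upper_copula power2_eq_square field_simps\<close>)
  next
    case 5
    define s where "s = sqrt (20 - 19 * g)"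
    have "14/5 \<le> s" unfolding s_def by (rule real_le_rsqrt) (use 5 g in \<open>simp_all add: power2_eq_square\<close>)
    moreover have "s < 15/4" unfolding s_def by (rule real_less_lsqrt) (use 5 g in \<open>simp_all add: power2_eq_square\<close>)
    moreover have "s * s = 20 - 19 * g" using 5 g by (simp add: s_def)
    ultimately have s: "14/5 \<le> s" "s < 15/4" "g = (20 - s * s) / 19" by simp_all
    have bound: "(s + 1) / 19 = asymmetry_bound g" using 5 by (simp add: asymmetry_bound_def s_def)
    show ?thesis
      by (rule upper_copula_attains[OF bound])
        (use 5 s in \<open>simp_all add: gini_gamma_upper_copula power2_eq_square field_simps\<close>)
  next
    case 6
    define s where "s = sqrt (9 - 11 * g)"
    have "2/3 \<le> s" unfolding s_def by (rule real_le_rsqrt) (use 6 g in \<open>simp_all add: power2_eq_square\<close>)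
    moreover have "s < 7/5" unfolding s_def by (rule real_less_lsqrt) (use 6 g in \<open>simp_all add: power2_eq_square\<close>)
    moreover have "s * s = 9 - 11 * g" using 6 g by (simp add: s_def)
    ultimately have s: "2/3 \<le> s" "s < 7/5" "g = (9 - s * s) / 11" by simp_all
    have bound: "(s + 3) / 22 = asymmetry_bound g" using 6 by (simp add: asymmetry_bound_def s_def)
    show ?thesis
      by (rule upper_copula_attains[OF bound])
        (use 6 s in \<open>simp_all add: gini_gamma_upper_copula power2_eq_square field_simps\<close>)
  next
    case 7
    define s where "s = sqrt (2 - 2 * g)"
    have "0 \<le> s" using 7 g by (simp add: s_def)
    moreover have "s < 2/3" unfolding s_def by (rule real_less_lsqrt) (use 7 g in \<open>simp_all add: power2_eq_square\<close>)
    moreover have "s * s = 2 - 2 * g" using 7 g by (simp add: s_def)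
    ultimately have s: "0 \<le> s" "s < 2/3" "g = (2 - s * s) / 2" by simp_all
    have bound: "s / 4 = asymmetry_bound g" using 7 by (simp add: asymmetry_bound_def s_def)
    show ?thesis
      by (rule upper_copula_attains[OF bound])
        (use 7 s in \<open>simp_all add: gini_gamma_upper_copula power2_eq_square field_simps\<close>)
  qed
qed

text \<open>Mixtures of the symmetric copulas \<open>copula_W\<close> and \<open>copula_M\<close>
  are symmetric, and their \<gamma> runs linearly from \<open>- 1\<close> to
  \<open>1\<close>.\<close>

lemma zero_asymmetry_attained:
  assumes g: "- 1 \<le> g" "g \<le> 1"
  shows "\<exists>C. copula C \<and> gini_gamma C = g \<and> asymmetry C = 0"
proof -
  define s where "s = (1 + g) / 2"
  have s: "0 \<le> s" "s \<le> 1" using g by (auto simp: s_def)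
  let ?C = "\<lambda>u v. (1 - s) * copula_W u v + s * copula_M u v"
  have "copula ?C" using copula_W copula_M s by (rule copula_convex)
  moreover have "gini_gamma ?C = g"
    using gini_gamma_convex[OF copula_W copula_M s] by (simp add: gini_gamma_W gini_gamma_M s_def field_simps)
  moreover have "asymmetry ?C = 0"
    by (simp add: asymmetry_def copula_W_def copula_M_def add.commute min.commute)
  ultimately show ?thesis by blast
qed

theorem corollary19:
  shows "(\<forall>C \<gamma>. copula C \<and> gini_gamma C = \<gamma> \<longrightarrow>
            0 \<le> asymmetry C \<and> asymmetry C \<le> asymmetry_bound \<gamma>) \<and>
         (\<forall>\<gamma>\<in>{-1..1}.
            (\<exists>C. copula C \<and> gini_gamma C = \<gamma> \<and> asymmetry C = 0) \<and>
            (\<exists>C. copula C \<and> gini_gamma C = \<gamma> \<and> asymmetry C = asymmetry_bound \<gamma>))"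
proof (intro conjI allI ballI impI)
  fix C \<gamma> assume "copula C \<and> gini_gamma C = \<gamma>"
  hence C: "copula C" and \<gamma>: "gini_gamma C = \<gamma>" by simp_all
  show "0 \<le> asymmetry C" using asymmetry_ge[OF C, of 0 0] by simp
  show "asymmetry C \<le> asymmetry_bound \<gamma>"
    unfolding \<gamma>[symmetric] by (rule asymmetry_le) (rule abs_diff_le_asymmetry_bound[OF C])
next
  fix \<gamma> :: real assume "\<gamma> \<in> {-1..1}"
  hence \<gamma>: "- 1 \<le> \<gamma>" "\<gamma> \<le> 1" by simp_all
  show "\<exists>C. copula C \<and> gini_gamma C = \<gamma> \<and> asymmetry C = 0"
    by (rule zero_asymmetry_attained[OF \<gamma>])
  show "\<exists>C. copula C \<and> gini_gamma C = \<gamma> \<and> asymmetry C = asymmetry_bound \<gamma>"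
    by (rule asymmetry_bound_attained[OF \<gamma>])
qed

end
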